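(* Let $U,V\in\mathbb{R}^{n\times m}$ and let $\tilde U,\tilde V$ be obtained by independently perturbing every entry by an $\mathcal{N}(0,\rho^2)$ random variable. There is an absolute constant $C$ such that whenever $m\le n^2/C$, with probability $1-\exp(-\Omega(n))$, \[ \sigma_{\min}(\tilde U\odot\tilde V)\ge\mathrm{poly}\big(\rho,\tfrac1n\big). \]
   Context: $\tilde U\odot\tilde V\in\mathbb{R}^{n^2\times m}$ is the Khatri–Rao product, whose $i$-th column is $\tilde u_i\otimes\tilde v_i$ (Kronecker product of the $i$-th columns). $\sigma_{\min}$ denotes the $m$-th (smallest) singular value. *)

theory Defs
  imports "HOL-Probability.Probability" "Jordan_Normal_Form.Char_Poly"
begin

text \<open>
  Dimensions vary inside the statement (the constants must not depend on them), so matrices are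
  those of \<^theory>\<open>Jordan_Normal_Form.Matrix\<close>. Names also used by HOL-Analysis are qualified.
\<close>

definition kron_vec :: "real Matrix.vec \<Rightarrow> real Matrix.vec \<Rightarrow> real Matrix.vec" where
  "kron_vec u v = Matrix.vec (dim_vec u * dim_vec v)
     (\<lambda>i. vec_index u (i div dim_vec v) * vec_index v (i mod dim_vec v))"

definition khatri_rao :: "real Matrix.mat \<Rightarrow> real Matrix.mat \<Rightarrow> real Matrix.mat" where
  "khatri_rao A B = mat_of_cols (dim_row A * dim_row B)
     (map (\<lambda>j. kron_vec (Matrix.col A j) (Matrix.col B j)) [0..<dim_col A])"

text \<open>
  Square roots of the eigenvalues of \<open>A\<^sup>T A\<close>, repeated according to multiplicity, in decreasing
  order. As \<open>A\<^sup>T A\<close> is symmetric positive semidefinite, its characteristic polynomial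
  splits over the reals and the list has exactly \<^term>\<open>dim_col A\<close> entries.
\<close>
definition singular_values :: "real Matrix.mat \<Rightarrow> real list" where
  "singular_values A =
     rev (sorted_list_of_multiset (image_mset sqrt (proots (char_poly (A\<^sup>T * A)))))"

definition sigma_min :: "real Matrix.mat \<Rightarrow> real" where
  "sigma_min A = singular_values A ! (dim_col A - 1)"

definition gaussian_noise :: "nat \<Rightarrow> nat \<Rightarrow> real \<Rightarrow> (nat \<times> nat \<Rightarrow> real) measure" where
  "gaussian_noise n m \<rho> =
     (\<Pi>\<^sub>M ij \<in> {..<n} \<times> {..<m}. density lborel (\<lambda>x. ennreal (normal_density 0 \<rho> x)))"

definition perturb :: "real Matrix.mat \<Rightarrow> (nat \<times> nat \<Rightarrow> real) \<Rightarrow> real Matrix.mat" where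
  "perturb U g = Matrix.mat (dim_row U) (dim_col U) (\<lambda>ij. U $$ ij + g ij)"

end

theory Submission
  imports Defs
begin

text \<open>
  Write \<open>c\<^sub>j = u\<^sub>j \<otimes> v\<^sub>j\<close> for the perturbed columns. If \<open>\<sigma>\<^sub>m\<^sub>i\<^sub>n\<close> is small, then some \<open>c\<^sub>i\<close> is close to the
  span of the others, so it suffices to bound the probability of that event for fixed \<open>c\<^sub>j\<close>
  (\<open>j \<noteq> i\<close>), using only the randomness of \<open>u\<^sub>i\<close> and \<open>v\<^sub>i\<close>, and to take a union bound over \<open>i\<close>.

  The orthogonal complement of the other columns is a space \<open>W\<close> of \<open>n \<times> n\<close> matrices of dimension
  at least \<open>n\<^sup>2 / 2\<close>. Gaussian elimination with complete pivoting yields an echelon system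
  in \<open>W\<close> whose entries are bounded by 1 and whose pivots equal 1, and by pigeonhole some row contains
  \<open>n / 4\<close> pivots. Passing to the matrices of \<open>W\<close> that vanish on that row and repeating gives
  \<open>n / 4\<close> rows with \<open>n / 4\<close> pivots each. Except with probability \<open>exp (- \<Omega>(n))\<close> over \<open>v\<^sub>i\<close>, every such row \<open>r\<close>
  has a matrix \<open>B\<close> for which \<open>(B v\<^sub>i)\<^sub>r\<close> is not small. The vectors \<open>B v\<^sub>i\<close> are then triangular with
  respect to the selected rows, so their inner products with \<open>u\<^sub>i\<close> are all small only with
  probability \<open>exp (- \<Omega>(n))\<close>. Complete pivoting is what avoids any exponential loss here.
\<close>

section \<open>Linear algebra: bounded echelon systems by complete pivoting\<close>

text \<open>Gaussian elimination: an equation with a nonzero coefficient at \<open>q\<close> serves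
  to remove the unknown \<open>q\<close> from the others, which leaves one equation and one unknown
  fewer.\<close>

lemma homogeneous_system_nontrivial_solution:
  fixes c :: "'j \<Rightarrow> 'p \<Rightarrow> real"
  assumes "finite J" "finite P" "card J < card P"
  shows "\<exists>B. (\<exists>p\<in>P. B p \<noteq> 0) \<and> (\<forall>j\<in>J. (\<Sum>p\<in>P. B p * c j p) = 0)"
  using assms
proof (induction J arbitrary: P c rule: finite_induct)
  case empty
  then have "P \<noteq> {}" by auto
  then show ?case by (intro exI[of _ "\<lambda>_. 1"]) auto
next
  case (insert j J)
  show ?case
  proof (cases "\<forall>p\<in>P. c j p = 0")
    case True
    have "card J < card P" using insert by simp
    from insert.IH[OF insert.prems(1) this, of c] obtain B
      where "\<exists>p\<in>P. B p \<noteq> 0" "\<forall>k\<in>J. (\<Sum>p\<in>P. B p * c k p) = 0" by blast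
    with True show ?thesis by (intro exI[of _ B]) auto
  next
    case False
    then obtain q where q: "q \<in> P" "c j q \<noteq> 0" by blast
    define c' where "c' k p = c k p - c k q / c j q * c j p" for k p
    have "finite (P - {q})" "card J < card (P - {q})" using insert q by simp_all
    from insert.IH[OF this, of c'] obtain B
      where B: "\<exists>p\<in>P-{q}. B p \<noteq> 0" "\<And>k. k \<in> J \<Longrightarrow> (\<Sum>p\<in>P-{q}. B p * c' k p) = 0" by blast
    \<comment> \<open>The value that equation \<open>j\<close> forces on the eliminated unknown;
      inserting it turns the reduced equations back into the original ones.\<close>
    define b where "b = - (\<Sum>p\<in>P-{q}. B p * c j p) / c j q"
    have s: "(\<Sum>p\<in>P. (B(q:=b)) p * c k p) = b * c k q + (\<Sum>p\<in>P-{q}. B p * c k p)" for k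
      using q insert.prems by (subst sum.remove[of _ q]) auto
    have "(\<Sum>p\<in>P. (B(q:=b)) p * c k p) = 0" if "k \<in> J" for k
    proof -
      have "0 = (\<Sum>p\<in>P-{q}. B p * c k p - c k q / c j q * (B p * c j p))"
        using B(2)[OF that] by (simp add: c'_def algebra_simps)
      also have "\<dots> = (\<Sum>p\<in>P-{q}. B p * c k p) - c k q / c j q * (\<Sum>p\<in>P-{q}. B p * c j p)"
        by (simp add: sum_subtractf sum_distrib_left)
      finally show ?thesis by (subst s) (simp add: b_def)
    qed
    moreover have "(\<Sum>p\<in>P. (B(q:=b)) p * c j p) = 0"
      using q by (subst s) (simp add: b_def)
    ultimately show ?thesis using B(1)
      by (intro exI[of _ "B(q:=b)"]) auto
  qed
qed

text \<open>Complete pivoting: dividing a nontrivial solution by its entry of largest modulus makes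
  that entry 1 and bounds the others by 1. Positions in \<open>Z\<close> are dropped from the
  unknowns and refilled with 0, so the unknowns to count are those in \<open>P - Z\<close>.\<close>

lemma exists_normalised_solution:
  fixes c :: "'j \<Rightarrow> 'p \<Rightarrow> real"
  assumes "finite J" "finite P" "Z \<subseteq> P" "card J + card Z < card P"
  shows "\<exists>B q. q \<in> P - Z \<and> B q = 1 \<and> (\<forall>p. \<bar>B p\<bar> \<le> 1) \<and> (\<forall>p\<in>Z. B p = 0) \<and>
    (\<forall>j\<in>J. (\<Sum>p\<in>P. B p * c j p) = 0)"
proof -
  have Z: "finite Z" using assms finite_subset by blast
  have "card J < card (P - Z)" using assms Z by (simp add: card_Diff_subset)
  then obtain B where B: "\<exists>p\<in>P-Z. B p \<noteq> 0" "\<And>j. j \<in> J \<Longrightarrow> (\<Sum>p\<in>P-Z. B p * c j p) = 0"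
    using homogeneous_system_nontrivial_solution[of J "P - Z" c] assms by blast
  define q where "q = arg_min_on (\<lambda>p. - \<bar>B p\<bar>) (P - Z)"
  have f: "finite (P - Z)" "P - Z \<noteq> {}" using assms B by auto
  have max: "q \<in> P - Z" "\<And>p. p \<in> P - Z \<Longrightarrow> \<bar>B p\<bar> \<le> \<bar>B q\<bar>"
    using arg_min_if_finite[OF f, of "\<lambda>p. - \<bar>B p\<bar>"] unfolding q_def by (force simp: not_less)+
  then have nz: "B q \<noteq> 0" using B(1) by fastforce
  define D where "D p = (if p \<in> P - Z then B p / B q else 0)" for p
  have "(\<Sum>p\<in>P. D p * c j p) = 0" if "j \<in> J" for j
  proof -
    have "(\<Sum>p\<in>P. D p * c j p) = (\<Sum>p\<in>P-Z. D p * c j p)"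
      using assms by (intro sum.mono_neutral_right) (auto simp: D_def)
    also have "\<dots> = (\<Sum>p\<in>P-Z. B p * c j p) / B q"
      unfolding sum_divide_distrib by (rule sum.cong) (auto simp: D_def)
    finally show ?thesis using B(2)[OF that] by simp
  qed
  moreover have "\<bar>D p\<bar> \<le> 1" for p
    using max(2)[of p] nz by (auto simp: D_def)
  moreover have "D q = 1" using max nz by (auto simp: D_def)
  moreover have "\<forall>p\<in>Z. D p = 0" by (simp add: D_def)
  ultimately show ?thesis using max(1) by blast
qed

text \<open>Each new solution is made to vanish on \<open>Z\<close> and on all earlier pivots, which
  the dimension count allows \<open>d\<close> times. Earlier solutions are never modified, so no
  growth of entries accumulates and the bound 1 is independent of \<open>d\<close>.\<close>

lemma exists_bounded_echelon_system:
  fixes c :: "'j \<Rightarrow> 'p \<Rightarrow> real"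
  assumes "finite J" "finite P" "Z \<subseteq> P" "card J + card Z + d \<le> card P"
  shows "\<exists>p B. (\<forall>k<d. p k \<in> P - Z \<and> B k (p k) = 1 \<and> (\<forall>q. \<bar>B k q\<bar> \<le> 1) \<and>
    (\<forall>q\<in>Z. B k q = 0) \<and> (\<forall>l<k. B k (p l) = 0) \<and> (\<forall>j\<in>J. (\<Sum>q\<in>P. B k q * c j q) = 0))"
  using assms(4)
proof (induction d)
  case 0
  then show ?case by simp
next
  case (Suc d)
  then obtain p B where pB: "\<forall>k<d. p k \<in> P - Z \<and> B k (p k) = 1 \<and>
    (\<forall>q. \<bar>B k q\<bar> \<le> 1) \<and> (\<forall>q\<in>Z. B k q = 0) \<and> (\<forall>l<k. B k (p l) = 0) \<and>
    (\<forall>j\<in>J. (\<Sum>q\<in>P. B k q * c j q) = 0)"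
    by auto
  define Z' where "Z' = Z \<union> p ` {..<d}"
  have fZ: "finite Z" using assms finite_subset by blast
  have "Z' \<subseteq> P" using pB assms by (auto simp: Z'_def)
  moreover have "card Z' \<le> card Z + d"
    unfolding Z'_def using card_Un_le[of Z "p ` {..<d}"] card_image_le[of "{..<d}" p] by simp
  then have "card J + card Z' < card P" using Suc.prems by simp
  ultimately obtain D q where D: "q \<in> P - Z'" "D q = 1" "\<forall>r. \<bar>D r\<bar> \<le> 1" "\<forall>r\<in>Z'. D r = 0"
    "\<forall>j\<in>J. (\<Sum>r\<in>P. D r * c j r) = 0"
    using exists_normalised_solution[OF assms(1,2), of Z' c] by blast
  have q: "q \<in> P - Z" "q \<notin> p ` {..<d}" using D(1) by (auto simp: Z'_def)
  have "\<forall>k<Suc d. (p(d:=q)) k \<in> P - Z \<and> (B(d:=D)) k ((p(d:=q)) k) = 1 \<and>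
    (\<forall>r. \<bar>(B(d:=D)) k r\<bar> \<le> 1) \<and> (\<forall>r\<in>Z. (B(d:=D)) k r = 0) \<and>
    (\<forall>l<k. (B(d:=D)) k ((p(d:=q)) l) = 0) \<and> (\<forall>j\<in>J. (\<Sum>r\<in>P. (B(d:=D)) k r * c j r) = 0)"
  proof (intro allI impI)
    fix k assume "k < Suc d"
    then consider "k < d" | "k = d" by linarith
    then show "(p(d:=q)) k \<in> P - Z \<and> (B(d:=D)) k ((p(d:=q)) k) = 1 \<and>
      (\<forall>r. \<bar>(B(d:=D)) k r\<bar> \<le> 1) \<and> (\<forall>r\<in>Z. (B(d:=D)) k r = 0) \<and>
      (\<forall>l<k. (B(d:=D)) k ((p(d:=q)) l) = 0) \<and> (\<forall>j\<in>J. (\<Sum>r\<in>P. (B(d:=D)) k r * c j r) = 0)"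
    proof cases
      case 1
      then show ?thesis using pB by auto
    next
      case 2
      then show ?thesis using D q by (auto simp: Z'_def)
    qed
  qed
  then show ?case by blast
qed

text \<open>One row \<open>i\<close> with many pivots, in columns \<open>q k\<close>. The matrices
  \<open>B k\<close> are orthogonal to all \<open>c j\<close> and vanish on the rows
  \<open>I\<close> taken by earlier blocks. \<open>K\<close> is a general finite set because
  pigeonhole selects it from the indices of a longer echelon system.\<close>

definition row_echelon_block ::
  "nat \<Rightarrow> ('j \<Rightarrow> nat \<times> nat \<Rightarrow> real) \<Rightarrow> 'j set \<Rightarrow> nat set \<Rightarrow> nat \<Rightarrow> nat set \<Rightarrow> (nat \<Rightarrow> nat) \<Rightarrow>
    (nat \<Rightarrow> nat \<times> nat \<Rightarrow> real) \<Rightarrow> bool" where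
  "row_echelon_block n c J I i K q B \<longleftrightarrow>
    i < n \<and> finite K \<and> n \<le> 4 * card K \<and>
    (\<forall>k\<in>K. q k < n \<and> B k (i, q k) = 1 \<and> (\<forall>x. \<bar>B k x\<bar> \<le> 1) \<and>
      (\<forall>i'\<in>I. \<forall>l<n. B k (i', l) = 0) \<and> (\<forall>l\<in>K. l < k \<longrightarrow> B k (i, q l) = 0) \<and>
      (\<forall>j\<in>J. (\<Sum>x\<in>{..<n}\<times>{..<n}. B k x * c j x) = 0))"

text \<open>Orthogonality to the \<open>c j\<close> costs at most n^2/2 dimensions and vanishing on
  the rows \<open>I\<close> at most n^2/4, so at least n^2/4 pivots remain. They are spread over n
  rows, hence some row holds n/4 of them, and a subfamily of an echelon system stays
  triangular.\<close>

lemma exists_row_echelon_block: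
  fixes c :: "'j \<Rightarrow> nat \<times> nat \<Rightarrow> real"
  assumes n: "0 < n" and J: "finite J" "2 * card J \<le> n * n" and I: "I \<subseteq> {..<n}" "4 * card I \<le> n"
  shows "\<exists>i K q B. row_echelon_block n c J I i K q B"
proof -
  define P where "P = {..<n} \<times> {..<n}"
  define Z where "Z = I \<times> {..<n}"
  define d where "d = n * n - card I * n - card J"
  have cP: "finite P" "card P = n * n" by (auto simp: P_def)
  have cZ: "Z \<subseteq> P" "card Z = card I * n" using I by (auto simp: P_def Z_def card_cartesian_product)
  have "4 * card I * n \<le> n * n" using I(2) by simp
  then have d4: "n * n \<le> 4 * d" and d: "card J + card Z + d \<le> card P"
    using J(2) unfolding d_def cZ(2) cP(2) by linarith+
  obtain p B where pB: "\<forall>k<d. p k \<in> P - Z \<and> B k (p k) = 1 \<and>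
      (\<forall>q. \<bar>B k q\<bar> \<le> 1) \<and> (\<forall>q\<in>Z. B k q = 0) \<and> (\<forall>l<k. B k (p l) = 0) \<and>
      (\<forall>j\<in>J. (\<Sum>q\<in>P. B k q * c j q) = 0)"
    using exists_bounded_echelon_system[OF J(1) cP(1) cZ(1) d, of c] by blast
  define K where "K i = {k. k < d \<and> fst (p k) = i}" for i
  have "\<exists>i<n. n \<le> 4 * card (K i)"
  proof (rule ccontr)
    assume "\<not> ?thesis"
    then have lt: "4 * card (K i) < n" if "i < n" for i using that by auto
    have "{..<d} = (\<Union>i<n. K i)"
      using pB by (force simp: K_def P_def)
    then have "d \<le> (\<Sum>i<n. card (K i))"
      using card_UN_le[of "{..<n}" K] by (metis card_lessThan finite_lessThan)
    then have "4 * d \<le> (\<Sum>i<n. 4 * card (K i))" by (simp add: sum_distrib_left [symmetric])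
    also have "\<dots> < (\<Sum>i<n. n)" using lt n by (intro sum_strict_mono) auto
    finally show False using d4 by simp
  qed
  then obtain i where i: "i < n" "n \<le> 4 * card (K i)" by blast
  have "p k = (i, snd (p k))" if "k \<in> K i" for k using that by (auto simp: K_def)
  moreover have "finite (K i)" by (simp add: K_def)
  ultimately have "row_echelon_block n c J I i (K i) (snd \<circ> p) B"
    unfolding row_echelon_block_def using i pB
    by (auto simp: K_def P_def Z_def)
  then show ?thesis by blast
qed

text \<open>Each block vanishes on the rows chosen before, so the blocks are also triangular among
  themselves with respect to the rows \<open>i s\<close>. The last block has only
  \<open>r - 1\<close> rows to avoid, which is why \<open>4 * r \<le> n + 4\<close>
  suffices.\<close>

lemma exists_row_echelon_blocks:
  fixes c :: "'j \<Rightarrow> nat \<times> nat \<Rightarrow> real"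
  assumes n: "0 < n" and J: "finite J" "2 * card J \<le> n * n" and r: "4 * r \<le> n + 4"
  shows "\<exists>i K q B. \<forall>s<r. row_echelon_block n c J (i ` {..<s}) (i s) (K s) (q s) (B s)"
  using r
proof (induction r)
  case 0
  then show ?case by simp
next
  case (Suc r)
  then obtain i K q B
    where IH: "\<forall>s<r. row_echelon_block n c J (i ` {..<s}) (i s) (K s) (q s) (B s)" by auto
  have "i ` {..<r} \<subseteq> {..<n}" using IH by (auto simp: row_echelon_block_def)
  moreover have "4 * card (i ` {..<r}) \<le> n"
    using card_image_le[of "{..<r}" i] Suc.prems by simp
  ultimately obtain i' K' q' B' where "row_echelon_block n c J (i ` {..<r}) i' K' q' B'"
    using exists_row_echelon_block[OF n J, of "i ` {..<r}" c] by blast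
  moreover have "{..<s} \<inter> {x. x \<noteq> r} = {..<s}" if "s \<le> r" for s
    using that by auto
  ultimately have "\<forall>s<Suc r. row_echelon_block n c J ((i(r:=i')) ` {..<s}) ((i(r:=i')) s)
      ((K(r:=K')) s) ((q(r:=q')) s) ((B(r:=B')) s)"
    using IH by (auto simp: less_Suc_eq)
  then show ?case by blast
qed

section \<open>Small-ball estimates for Gaussian vectors\<close>

abbreviation gaussian :: "real \<Rightarrow> real measure" where
  "gaussian \<rho> \<equiv> density lborel (\<lambda>x. ennreal (normal_density 0 \<rho> x))"

text \<open>The set is an interval of length \<open>2 * \<beta> / \<bar>a\<bar>\<close>, and the
  density is at most \<open>1 / (2 * \<rho>)\<close> because
  \<open>2 \<le> sqrt (2 * pi)\<close>.\<close>

lemma emeasure_gaussian_affine_le: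
  fixes a b \<alpha> \<beta> \<rho> :: real
  assumes "0 < \<rho>" "0 < \<alpha>" "\<alpha> \<le> \<bar>a\<bar>" "0 \<le> \<beta>"
  shows "emeasure (gaussian \<rho>) {x. \<bar>b + a * x\<bar> \<le> \<beta>} \<le> ennreal (\<beta> / (\<alpha> * \<rho>))"
proof -
  have a: "a \<noteq> 0" using assms by auto
  have ab: "\<bar>b + a * x\<bar> = \<bar>a\<bar> * \<bar>x - (- b / a)\<bar>" for x
    using a by (simp add: abs_mult [symmetric] algebra_simps)
  have "\<bar>b + a * x\<bar> \<le> \<beta> \<longleftrightarrow> \<bar>x - (- b / a)\<bar> \<le> \<beta> / \<bar>a\<bar>" for x
    using ab[of x] pos_le_divide_eq[of "\<bar>a\<bar>" "\<bar>x - (- b / a)\<bar>" \<beta>] a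
    by (simp only: mult.commute zero_less_abs_iff simp_thms)
  then have eq: "{x. \<bar>b + a * x\<bar> \<le> \<beta>} = {- b / a - \<beta> / \<bar>a\<bar> .. - b / a + \<beta> / \<bar>a\<bar>}" (is "_ = ?S")
    by (simp only: set_eq_iff abs_diff_le_iff simp_thms mem_Collect_eq atLeastAtMost_iff)
  have "2 * \<rho> = sqrt ((2 * \<rho>)\<^sup>2)" using assms by (simp only: real_sqrt_abs)
  also have "\<dots> \<le> sqrt (2 * pi * \<rho>\<^sup>2)"
    using pi_gt3 by (intro real_sqrt_le_mono) (simp add: power_mult_distrib mult_right_mono)
  finally have rt: "2 * \<rho> \<le> sqrt (2 * pi * \<rho>\<^sup>2)" .
  have "normal_density 0 \<rho> x \<le> 1 / (2 * \<rho>)" for x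
  proof -
    have "normal_density 0 \<rho> x \<le> 1 / sqrt (2 * pi * \<rho>\<^sup>2)"
      unfolding normal_density_def
      by (simp add: divide_right_mono)
    also have "\<dots> \<le> 1 / (2 * \<rho>)" using rt assms by (intro divide_left_mono) auto
    finally show ?thesis .
  qed
  then have "emeasure (gaussian \<rho>) ?S \<le> (\<integral>\<^sup>+x. ennreal (1 / (2 * \<rho>)) * indicator ?S x \<partial>lborel)"
    by (subst emeasure_density) (auto intro!: nn_integral_mono mult_right_mono ennreal_leI)
  also have "\<dots> = ennreal (1 / (2 * \<rho>)) * ennreal (2 * \<beta> / \<bar>a\<bar>)"
    using assms by (subst nn_integral_cmult_indicator) auto
  also have "\<dots> = ennreal (\<beta> / (\<bar>a\<bar> * \<rho>))"
    using assms by (subst ennreal_mult [symmetric]) (auto simp: field_simps)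
  also have "\<dots> \<le> ennreal (\<beta> / (\<alpha> * \<rho>))"
    using assms by (intro ennreal_leI divide_left_mono mult_right_mono) auto
  finally show ?thesis unfolding eq .
qed

text \<open>The form of least index is the only one involving its pivot coordinate, so integrating that
  coordinate out first costs one factor and leaves the remaining forms untouched.\<close>

lemma gaussian_triangular_small_ball:
  fixes a :: "nat \<Rightarrow> 'i \<Rightarrow> real" and b :: "nat \<Rightarrow> real" and p :: "nat \<Rightarrow> 'i"
  assumes \<rho>: "0 < \<rho>" and \<alpha>: "0 < \<alpha>" and \<beta>: "0 \<le> \<beta>" and I: "finite I" and K: "finite K"
    and p: "\<And>k. k \<in> K \<Longrightarrow> p k \<in> I" and piv: "\<And>k. k \<in> K \<Longrightarrow> \<alpha> \<le> \<bar>a k (p k)\<bar>"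
    and tri: "\<And>k l. k \<in> K \<Longrightarrow> l \<in> K \<Longrightarrow> l < k \<Longrightarrow> a k (p l) = 0"
  shows "emeasure (Pi\<^sub>M I (\<lambda>_. gaussian \<rho>))
      {x \<in> space (Pi\<^sub>M I (\<lambda>_. gaussian \<rho>)). \<forall>k\<in>K. \<bar>b k + (\<Sum>i\<in>I. a k i * x i)\<bar> \<le> \<beta>}
    \<le> ennreal ((\<beta> / (\<alpha> * \<rho>)) ^ card K)"
  using K p piv tri
proof (induction K rule: finite_linorder_min_induct)
  case empty
  interpret prob_space "gaussian \<rho>" by (rule prob_space_normal_density[OF \<rho>])
  interpret product_prob_space "\<lambda>_. gaussian \<rho>" I by standard
  show ?case using P.emeasure_space_1 by simp
next
  case (insert k K)
  interpret g: prob_space "gaussian \<rho>" by (rule prob_space_normal_density[OF \<rho>])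
  interpret product_sigma_finite "\<lambda>_. gaussian \<rho>" by standard
  define I' where "I' = I - {p k}"
  have I': "finite I'" "p k \<notin> I'" "I = insert (p k) I'" using I insert.prems(1)[of k] by (auto simp: I'_def)
  let ?L = "\<lambda>l x. b l + (\<Sum>i\<in>I. a l i * x i)"
  let ?M = "Pi\<^sub>M I (\<lambda>_. gaussian \<rho>)" and ?M' = "Pi\<^sub>M I' (\<lambda>_. gaussian \<rho>)"
  let ?E = "{x \<in> space ?M. \<forall>l\<in>K. \<bar>?L l x\<bar> \<le> \<beta>}"
  let ?F = "{x \<in> space ?M. \<forall>l\<in>insert k K. \<bar>?L l x\<bar> \<le> \<beta>}"
  have [measurable]: "Measurable.pred ?M (\<lambda>x. \<bar>?L l x\<bar> \<le> \<beta>)" for l by measurable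
  have E[measurable]: "?E \<in> sets ?M" and F[measurable]: "?F \<in> sets ?M"
    using insert.hyps(1) by auto
  have upd: "?L l (x(p k := y)) = (b l + (\<Sum>i\<in>I'. a l i * x i)) + a l (p k) * y" for l x y
  proof -
    have "(\<Sum>i\<in>I'. a l i * (x(p k := y)) i) = (\<Sum>i\<in>I'. a l i * x i)"
      using I'(2) by (intro sum.cong) auto
    then show ?thesis unfolding I'(3) using I' by simp
  qed
  \<comment> \<open>Every \<open>l \<in> K\<close> exceeds \<open>k\<close>, so triangularity gives
    \<open>a l (p k) = 0\<close>.\<close>
  have indep: "?L l (x(p k := y)) = b l + (\<Sum>i\<in>I'. a l i * x i)" if "l \<in> K" for l x y
    using insert.prems(3)[of l k] insert.hyps(2) that by (simp only: upd) simp
  have sp: "x(p k := y) \<in> space ?M" if "x \<in> space ?M'" for x y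
    using that I'(2,3) by (auto simp: space_PiM PiE_def extensional_def)
  have "emeasure ?M ?F = (\<integral>\<^sup>+x. indicator ?F x \<partial>?M)" by simp
  also have "\<dots> = (\<integral>\<^sup>+x. \<integral>\<^sup>+y. indicator ?F (x(p k := y)) \<partial>gaussian \<rho> \<partial>?M')"
    using product_nn_integral_insert[OF I'(1,2), of "indicator ?F"] F unfolding I'(3) by auto
  \<comment> \<open>With the other coordinates fixed, membership in \<open>?E\<close> does not
    depend on \<open>y\<close>. Either some form in \<open>K\<close> is already too large and the
    left side is 0, or the inner integral over \<open>?E\<close> is 1 and the form of index
    \<open>k\<close> confines \<open>y\<close> to a short interval.\<close>
  also have "\<dots> \<le> (\<integral>\<^sup>+x. ennreal (\<beta> / (\<alpha> * \<rho>)) *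
      (\<integral>\<^sup>+y. indicator ?E (x(p k := y)) \<partial>gaussian \<rho>) \<partial>?M')"
  proof (rule nn_integral_mono)
    fix x assume x: "x \<in> space ?M'"
    show "(\<integral>\<^sup>+y. indicator ?F (x(p k := y)) \<partial>gaussian \<rho>) \<le>
      ennreal (\<beta> / (\<alpha> * \<rho>)) * (\<integral>\<^sup>+y. indicator ?E (x(p k := y)) \<partial>gaussian \<rho>)"
    proof (cases "\<forall>l\<in>K. \<bar>b l + (\<Sum>i\<in>I'. a l i * x i)\<bar> \<le> \<beta>")
      case False
      then have "indicator ?F (x(p k := y)) = (0::ennreal)" for y
        using indep by (auto simp: indicator_def)
      then show ?thesis by simp
    next
      case True
      then have "indicator ?E (x(p k := y)) = (1::ennreal)" for y
        using indep sp[OF x] by (auto simp: indicator_def)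
      then have 1: "(\<integral>\<^sup>+y. indicator ?E (x(p k := y)) \<partial>gaussian \<rho>) = 1"
        using g.emeasure_space_1 by simp
      let ?S = "{y. \<bar>(b k + (\<Sum>i\<in>I'. a k i * x i)) + a k (p k) * y\<bar> \<le> \<beta>}"
      have S: "y \<in> ?S" if "x(p k := y) \<in> ?F" for y
      proof -
        from that have "\<bar>?L k (x(p k := y))\<bar> \<le> \<beta>" by blast
        then show ?thesis by (simp only: upd mem_Collect_eq)
      qed
      have "indicator ?F (x(p k := y)) \<le> (indicator ?S y :: ennreal)" for y
        by (cases "x(p k := y) \<in> ?F") (simp_all only: S indicator_simps not_False_eq_True order_refl zero_le)
      then have "(\<integral>\<^sup>+y. indicator ?F (x(p k := y)) \<partial>gaussian \<rho>) \<le> (\<integral>\<^sup>+y. indicator ?S y \<partial>gaussian \<rho>)"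
        by (rule nn_integral_mono)
      also have "\<dots> = emeasure (gaussian \<rho>) ?S"
        by (intro nn_integral_indicator) simp
      also have "\<dots> \<le> ennreal (\<beta> / (\<alpha> * \<rho>))"
        using insert.prems(2)[of k] by (intro emeasure_gaussian_affine_le \<rho> \<alpha> \<beta>) simp
      finally show ?thesis using 1 by simp
    qed
  qed
  also have "\<dots> = ennreal (\<beta> / (\<alpha> * \<rho>)) *
      (\<integral>\<^sup>+x. \<integral>\<^sup>+y. indicator ?E (x(p k := y)) \<partial>gaussian \<rho> \<partial>?M')"
  proof (rule nn_integral_cmult)
    have [measurable]: "(\<lambda>(x, y). x(p k := y)) \<in> ?M' \<Otimes>\<^sub>M gaussian \<rho> \<rightarrow>\<^sub>M ?M"
      unfolding I'(3) using measurable_add_dim[of "p k" I' "\<lambda>_. gaussian \<rho>"] by simp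
    have "(\<lambda>(x, y). indicator ?E (x(p k := y)) :: ennreal) =
        indicator ?E \<circ> (\<lambda>(x, y). x(p k := y))" by auto
    also have "\<dots> \<in> borel_measurable (?M' \<Otimes>\<^sub>M gaussian \<rho>)"
      by (rule measurable_comp[of _ _ ?M]) measurable
    finally show "(\<lambda>x. \<integral>\<^sup>+y. indicator ?E (x(p k := y)) \<partial>gaussian \<rho>) \<in> borel_measurable ?M'"
      by (rule g.borel_measurable_nn_integral)
  qed
  also have "(\<integral>\<^sup>+x. \<integral>\<^sup>+y. indicator ?E (x(p k := y)) \<partial>gaussian \<rho> \<partial>?M') = (\<integral>\<^sup>+x. indicator ?E x \<partial>?M)"
    using product_nn_integral_insert[OF I'(1,2), of "indicator ?E"] E unfolding I'(3) by auto
  also have "\<dots> = emeasure ?M ?E" by simp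
  also have "\<dots> \<le> ennreal ((\<beta> / (\<alpha> * \<rho>)) ^ card K)"
    using insert by simp
  finally have "emeasure ?M ?F \<le> ennreal (\<beta> / (\<alpha> * \<rho>)) * ennreal ((\<beta> / (\<alpha> * \<rho>)) ^ card K)"
    by (simp add: mult_left_mono)
  also have "\<dots> = ennreal ((\<beta> / (\<alpha> * \<rho>)) ^ card (insert k K))"
    using insert.hyps \<rho> \<alpha> \<beta> by (subst ennreal_mult [symmetric]) auto
  finally show ?case .
qed

lemma prob_space_gaussian_product:
  assumes "0 < \<rho>"
  shows "prob_space (Pi\<^sub>M I (\<lambda>_. gaussian \<rho>))"
  by (intro prob_space_PiM prob_space_normal_density assms)

lemma exp_power_le_exp:
  assumes "n \<le> 4 * k"
  shows "exp (- 20) ^ k \<le> exp (- 5 * real n)"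
proof -
  have "exp (- 20) ^ k = exp (real k * (- 20))" by (rule exp_of_nat_mult [symmetric])
  also have "\<dots> \<le> exp (- 5 * real n)" using assms by (subst exp_le_cancel_iff) linarith
  finally show ?thesis .
qed

text \<open>\<open>a\<close> and \<open>b\<close> are columns of the unperturbed matrices,
  \<open>g\<close> and \<open>h\<close> carry their noise, and \<open>f\<close> stands for the
  indicator of being near the span of the \<open>c j\<close>. First \<open>h\<close> has to avoid
  the bad events \<open>V s\<close>; for each such \<open>h\<close>, the conditions on
  \<open>g\<close> form a triangular system.\<close>

lemma gaussian_rank_one_anticoncentration:
  fixes c :: "'j \<Rightarrow> nat \<times> nat \<Rightarrow> real" and a b :: "nat \<Rightarrow> real" and \<rho> :: real and i :: 'i and n :: nat
    and f :: "(nat \<times> 'i \<Rightarrow> real) \<Rightarrow> (nat \<times> 'i \<Rightarrow> real) \<Rightarrow> ennreal"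
  defines "M \<equiv> Pi\<^sub>M ({..<n} \<times> {i}) (\<lambda>_. gaussian \<rho>)"
  assumes \<rho>: "0 < \<rho>" and n: "2 \<le> n" and J: "finite J" "2 * card J \<le> n * n"
    and f1: "\<And>g h. f g h \<le> 1"
    and f: "\<And>g h B. f g h \<noteq> 0 \<Longrightarrow> (\<And>x. \<bar>B x\<bar> \<le> 1) \<Longrightarrow>
      (\<And>j. j \<in> J \<Longrightarrow> (\<Sum>x\<in>{..<n}\<times>{..<n}. B x * c j x) = 0) \<Longrightarrow>
      \<bar>\<Sum>(k, l)\<in>{..<n}\<times>{..<n}. B (k, l) * ((a k + g (k, i)) * (b l + h (l, i)))\<bar> \<le> \<rho>\<^sup>2 * exp (- 40)"
  shows "(\<integral>\<^sup>+h. \<integral>\<^sup>+g. f g h \<partial>M \<partial>M) \<le> ennreal ((real n + 1) * exp (- 5 * real n))"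
proof -
  interpret M: prob_space M unfolding M_def by (rule prob_space_gaussian_product[OF \<rho>])
  \<comment> \<open>The largest number of blocks that \<open>4 * r \<le> n + 4\<close> permits;
    being at least n/4, it yields \<open>exp (- 20) ^ r \<le> exp (- 5 * real n)\<close>.\<close>
  define r where "r = n div 4 + 1"
  have r: "n \<le> 4 * r" "4 * r \<le> n + 4" "r \<le> n" using n unfolding r_def by presburger+
  obtain row K q B where
    blk: "\<forall>s<r. row_echelon_block n c J (row ` {..<s}) (row s) (K s) (q s) (B s)"
    using exists_row_echelon_blocks[of n J r c] n J r by auto
  have row: "row s < n" and K: "finite (K s)" "n \<le> 4 * card (K s)" if "s < r" for s
    using blk that by (auto simp: row_echelon_block_def)
  have B: "q s k < n" "B s k (row s, q s k) = 1" "\<bar>B s k x\<bar> \<le> 1"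
      "\<And>s' l. s' < s \<Longrightarrow> l < n \<Longrightarrow> B s k (row s', l) = 0"
      "\<And>l. l \<in> K s \<Longrightarrow> l < k \<Longrightarrow> B s k (row s, q s l) = 0"
      "\<And>j. j \<in> J \<Longrightarrow> (\<Sum>x\<in>{..<n}\<times>{..<n}. B s k x * c j x) = 0"
    if "s < r" "k \<in> K s" for s k x
    using blk that by (auto simp: row_echelon_block_def simp del: split_paired_All)
  let ?I = "{..<n} \<times> {i}"
  let ?w = "\<lambda>s k h. (\<Sum>l<n. B s k (row s, l) * b l) + (\<Sum>x\<in>?I. B s k (row s, fst x) * h x)"
  \<comment> \<open>\<open>?w s k h\<close> is the entry in \<open>row s\<close> of
    \<open>B s k\<close> applied to the perturbed column with mean \<open>b\<close>. In
    \<open>V s\<close> all pivots of block \<open>s\<close> give small entries, and each pivot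
    contributes a factor \<open>exp (- 20)\<close>.\<close>
  define V where "V s = {h \<in> space M. \<forall>k\<in>K s. \<bar>?w s k h\<bar> \<le> \<rho> * exp (- 20)}" for s
  have Vm[measurable]: "V s \<in> sets M" if "s < r" for s
    unfolding V_def M_def using K(1)[OF that] by measurable
  have V: "emeasure M (V s) \<le> ennreal (exp (- 5 * real n))" if s: "s < r" for s
  proof -
    have "emeasure M (V s) \<le> ennreal ((\<rho> * exp (- 20) / (1 * \<rho>)) ^ card (K s))"
      unfolding M_def V_def
      by (rule gaussian_triangular_small_ball[where p = "\<lambda>k. (q s k, i)"])
        (use \<rho> K(1)[OF s] B(1,2,5)[OF s] in simp_all)
    also have "\<dots> \<le> ennreal (exp (- 5 * real n))"
      using \<rho> exp_power_le_exp[OF K(2)[OF s]] by (intro ennreal_leI) simp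
    finally show ?thesis .
  qed
  have inner: "(\<integral>\<^sup>+g. f g h \<partial>M) \<le> (\<Sum>s<r. indicator (V s) h) + ennreal (exp (- 5 * real n))"
    if h: "h \<in> space M" for h
  proof (cases "\<exists>s<r. h \<in> V s")
    case True
    then obtain s where s: "s < r" "h \<in> V s" by blast
    have "(\<integral>\<^sup>+g. f g h \<partial>M) \<le> (\<integral>\<^sup>+g. 1 \<partial>M)" by (intro nn_integral_mono f1)
    also have "\<dots> = indicator (V s) h" using s M.emeasure_space_1 by simp
    also have "\<dots> \<le> (\<Sum>s<r. indicator (V s) h)"
      using s by (intro member_le_sum) auto
    finally show ?thesis by (simp add: add_increasing2)
  next
    case False
    then have "\<forall>s\<in>{..<r}. \<exists>k. k \<in> K s \<and> \<rho> * exp (- 20) < \<bar>?w s k h\<bar>"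
      using h by (auto simp: V_def not_le)
    from bchoice[OF this] obtain k
      where k: "\<And>s. s < r \<Longrightarrow> k s \<in> K s \<and> \<rho> * exp (- 20) < \<bar>?w s (k s) h\<bar>"
      by blast
    \<comment> \<open>\<open>A s\<close> is the vector \<open>B s (k s) v\<close> for the perturbed
      column \<open>v\<close>. It vanishes at \<open>row s'\<close> for \<open>s' < s\<close> and is
      not small at \<open>row s\<close>, so pairing the \<open>A s\<close> with the other column
      gives a triangular system with pivots \<open>row s\<close>.\<close>
    define A where "A s k' = (\<Sum>l<n. B s (k s) (k', l) * (b l + h (l, i)))" for s k'
    have A_row: "A s (row s) = ?w s (k s) h" for s
      by (simp add: A_def sum.cartesian_product' distrib_left sum.distrib)
    have A_0: "A s (row s') = 0" if "s < r" "s' < s" for s s'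
      using B(4)[OF that(1) _ that(2)] k[OF that(1)] by (simp add: A_def)
    have A_piv: "\<rho> * exp (- 20) \<le> \<bar>A s (row s)\<bar>" if "s < r" for s
      unfolding A_row using k[OF that] by simp
    let ?G = "{g \<in> space M. \<forall>s\<in>{..<r}. \<bar>(\<Sum>k'<n. A s k' * a k') + (\<Sum>x\<in>?I. A s (fst x) * g x)\<bar>
        \<le> \<rho>\<^sup>2 * exp (- 40)}"
    have [measurable]: "?G \<in> sets M" unfolding M_def by measurable
    have "f g h \<le> indicator ?G g" if g: "g \<in> space M" for g
    proof (cases "f g h = 0")
      case False
      have "\<bar>(\<Sum>k'<n. A s k' * a k') + (\<Sum>x\<in>?I. A s (fst x) * g x)\<bar> \<le> \<rho>\<^sup>2 * exp (- 40)"
        if s: "s < r" for s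
      proof -
        have "(\<Sum>(k', l)\<in>{..<n}\<times>{..<n}. B s (k s) (k', l) * ((a k' + g (k', i)) * (b l + h (l, i))))
            = (\<Sum>k'<n. A s k' * (a k' + g (k', i)))"
          unfolding A_def sum_distrib_right sum.cartesian_product'
          by (intro sum.cong refl) (simp add: algebra_simps)
        also have "\<dots> = (\<Sum>k'<n. A s k' * a k') + (\<Sum>x\<in>?I. A s (fst x) * g x)"
          by (simp add: sum.cartesian_product' distrib_left sum.distrib)
        finally show ?thesis
          using f[OF False, of "B s (k s)"] B(3,6)[OF s] k[OF s] by simp
      qed
      then show ?thesis using f1[of g h] g by simp
    qed simp
    then have "(\<integral>\<^sup>+g. f g h \<partial>M) \<le> (\<integral>\<^sup>+g. indicator ?G g \<partial>M)" by (intro nn_integral_mono)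
    also have "\<dots> = emeasure M ?G" by simp
    \<comment> \<open>The threshold \<open>\<rho>\<^sup>2 * exp (- 40)\<close> is chosen so that,
      after division by the pivot bound \<open>\<rho> * exp (- 20)\<close> and by
      \<open>\<rho>\<close>, each row again contributes \<open>exp (- 20)\<close>.\<close>
    also have "\<dots> \<le> ennreal ((\<rho>\<^sup>2 * exp (- 40) / (\<rho> * exp (- 20) * \<rho>)) ^ card {..<r})"
      unfolding M_def
      by (rule gaussian_triangular_small_ball[where p = "\<lambda>s. (row s, i)"])
        (use \<rho> row A_0 A_piv in simp_all)
    also have "\<rho>\<^sup>2 * exp (- 40) / (\<rho> * exp (- 20) * \<rho>) = exp (- 20)"
    proof -
      have "exp (- 40 :: real) = exp (- 20) * exp (- 20)" by (simp add: mult_exp_exp)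
      then show ?thesis using \<rho> by (simp add: power2_eq_square)
    qed
    also have "ennreal (exp (- 20) ^ card {..<r}) \<le> ennreal (exp (- 5 * real n))"
      using r by (intro ennreal_leI exp_power_le_exp) simp
    finally show ?thesis by (simp add: add_increasing)
  qed
  \<comment> \<open>There are \<open>r \<le> n\<close> bad events for \<open>h\<close> and one for
    \<open>g\<close>, which accounts for the factor \<open>real n + 1\<close>.\<close>
  have "(\<integral>\<^sup>+h. \<integral>\<^sup>+g. f g h \<partial>M \<partial>M)
      \<le> (\<integral>\<^sup>+h. (\<Sum>s<r. indicator (V s) h) + ennreal (exp (- 5 * real n)) \<partial>M)"
    by (intro nn_integral_mono inner)
  also have "\<dots> = (\<integral>\<^sup>+h. (\<Sum>s<r. indicator (V s) h) \<partial>M) + ennreal (exp (- 5 * real n))"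
    using Vm by (subst nn_integral_add) (auto simp: M.emeasure_space_1)
  also have "(\<integral>\<^sup>+h. (\<Sum>s<r. indicator (V s) h) \<partial>M) = (\<Sum>s<r. emeasure M (V s))"
    using Vm by (subst nn_integral_sum) auto
  also have "(\<Sum>s<r. emeasure M (V s)) + ennreal (exp (- 5 * real n))
      \<le> (\<Sum>s<r. ennreal (exp (- 5 * real n))) + ennreal (exp (- 5 * real n))"
    by (intro add_right_mono sum_mono V) simp
  also have "\<dots> = ennreal ((real r + 1) * exp (- 5 * real n))"
    by (simp add: ennreal_of_nat_eq_real_of_nat ennreal_mult [symmetric] ennreal_plus [symmetric]
        distrib_right del: ennreal_plus)
  also have "\<dots> \<le> ennreal ((real n + 1) * exp (- 5 * real n))"
    using r by (intro ennreal_leI mult_right_mono) auto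
  finally show ?thesis .
qed

section \<open>Conditioning on all columns but one\<close>

text \<open>Fubini: the coordinates in \<open>R\<close> are frozen at \<open>x\<close> and
  \<open>y\<close> in the two factors, and a bound on the remaining integral that is uniform in
  \<open>x\<close> and \<open>y\<close> bounds the whole.\<close>

lemma emeasure_pair_PiM_le:
  fixes R C :: "'i set" and N :: "'a measure" and K :: ennreal
  defines "M \<equiv> Pi\<^sub>M (R \<union> C) (\<lambda>_. N)" and "MR \<equiv> Pi\<^sub>M R (\<lambda>_. N)" and "MC \<equiv> Pi\<^sub>M C (\<lambda>_. N)"
  assumes N: "prob_space N" and RC: "finite R" "finite C" "R \<inter> C = {}"
    and S[measurable]: "S \<in> sets (M \<Otimes>\<^sub>M M)"
    and le: "\<And>x y. (\<integral>\<^sup>+h. \<integral>\<^sup>+g. indicator S (merge R C (x, g), merge R C (y, h)) \<partial>MC \<partial>MC) \<le> K"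
  shows "emeasure (M \<Otimes>\<^sub>M M) S \<le> K"
proof -
  interpret N: prob_space N by fact
  interpret product_sigma_finite "\<lambda>_::'i. N" by standard
  interpret M: prob_space M unfolding M_def by (intro prob_space_PiM N)
  interpret MR: prob_space MR unfolding MR_def by (intro prob_space_PiM N)
  interpret MC: prob_space MC unfolding MC_def by (intro prob_space_PiM N)
  interpret MM: pair_sigma_finite M M ..
  interpret RM: pair_sigma_finite MR M ..
  define F :: "('i \<Rightarrow> 'a) \<times> ('i \<Rightarrow> 'a) \<Rightarrow> ennreal" where "F = indicator S"
  have F[measurable]: "F \<in> borel_measurable (M \<Otimes>\<^sub>M M)" unfolding F_def by measurable
  have [measurable]: "merge R C \<in> MR \<Otimes>\<^sub>M MC \<rightarrow>\<^sub>M M"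
    unfolding M_def MR_def MC_def by (rule measurable_merge)
  have fold: "(\<integral>\<^sup>+g. f g \<partial>M) = (\<integral>\<^sup>+x. \<integral>\<^sup>+g. f (merge R C (x, g)) \<partial>MC \<partial>MR)"
    if "f \<in> borel_measurable M" for f
    using product_nn_integral_fold[OF RC(3,1,2)] that unfolding M_def MR_def MC_def by blast
  have "emeasure (M \<Otimes>\<^sub>M M) S = (\<integral>\<^sup>+h. \<integral>\<^sup>+g. F (g, h) \<partial>M \<partial>M)"
    by (subst MM.nn_integral_snd) (auto simp: F_def)
  also have "\<dots> = (\<integral>\<^sup>+h. \<integral>\<^sup>+x. \<integral>\<^sup>+g. F (merge R C (x, g), h) \<partial>MC \<partial>MR \<partial>M)"
    by (intro nn_integral_cong fold) measurable
  \<comment> \<open>Moving \<open>x\<close> past \<open>h\<close> lets the second factor be split as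
    well while \<open>g\<close> stays innermost, the order in which \<open>le\<close> is
    given.\<close>
  also have "\<dots> = (\<integral>\<^sup>+x. \<integral>\<^sup>+h. \<integral>\<^sup>+g. F (merge R C (x, g), h) \<partial>MC \<partial>M \<partial>MR)"
    by (intro RM.Fubini') measurable
  also have "\<dots> = (\<integral>\<^sup>+x. \<integral>\<^sup>+y. \<integral>\<^sup>+h. \<integral>\<^sup>+g. F (merge R C (x, g), merge R C (y, h)) \<partial>MC \<partial>MC \<partial>MR \<partial>MR)"
    by (intro nn_integral_cong fold) measurable
  also have "\<dots> \<le> (\<integral>\<^sup>+x. \<integral>\<^sup>+y. K \<partial>MR \<partial>MR)"
    unfolding F_def by (intro nn_integral_mono le)
  also have "\<dots> = K" by (simp add: MR.emeasure_space_1)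
  finally show ?thesis .
qed

section \<open>Distance of a column from the span of the others\<close>

text \<open>Rows are indexed by pairs instead of \<open>div\<close> and \<open>mod\<close>, so that
  a column of the Khatri-Rao product reads as an n x n matrix of rank at most one.\<close>

definition kr_entry ::
  "(nat \<times> nat \<Rightarrow> real) \<Rightarrow> (nat \<times> nat \<Rightarrow> real) \<Rightarrow> nat \<Rightarrow> nat \<times> nat \<Rightarrow> real" where
  "kr_entry u v j p = u (fst p, j) * v (snd p, j)"

lemma kr_entry_measurable:
  assumes "j < m" "p \<in> {..<n} \<times> {..<n}"
  shows "(\<lambda>\<omega>. kr_entry (\<lambda>x. u x + fst \<omega> x) (\<lambda>x. v x + snd \<omega> x) j p)
    \<in> borel_measurable (gaussian_noise n m \<rho> \<Otimes>\<^sub>M gaussian_noise n m \<rho>)"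
proof -
  have "(\<lambda>g. g x) \<in> borel_measurable (gaussian_noise n m \<rho>)" if "x \<in> {..<n} \<times> {..<m}" for x
    using measurable_component_singleton[OF that, of "\<lambda>_. gaussian \<rho>"]
    by (simp add: gaussian_noise_def)
  from this[of "(fst p, j)"] this[of "(snd p, j)"] assms
  have [measurable]: "(\<lambda>g. g (fst p, j)) \<in> borel_measurable (gaussian_noise n m \<rho>)"
    "(\<lambda>g. g (snd p, j)) \<in> borel_measurable (gaussian_noise n m \<rho>)" by auto
  show ?thesis unfolding kr_entry_def by measurable
qed

text \<open>Rational coefficients describe the same set as real ones, but only countably many
  conditions have to be checked for measurability.\<close>

definition near_span :: "nat \<Rightarrow> nat \<Rightarrow> real \<Rightarrow> nat \<Rightarrow> (nat \<times> nat \<Rightarrow> real) \<Rightarrow> (nat \<times> nat \<Rightarrow> real) \<Rightarrow> bool" where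
  "near_span n m \<delta> i u v \<longleftrightarrow> (\<exists>y\<in>{..<m} \<rightarrow>\<^sub>E \<rat>.
    (\<Sum>p\<in>{..<n}\<times>{..<n}. (kr_entry u v i p - (\<Sum>j\<in>{..<m}-{i}. y j * kr_entry u v j p))\<^sup>2) < \<delta>\<^sup>2)"

lemma near_span_measurable:
  fixes n m :: nat and \<rho> :: real
  defines "M \<equiv> gaussian_noise n m \<rho> \<Otimes>\<^sub>M gaussian_noise n m \<rho>"
  assumes "i < m"
  shows "{\<omega> \<in> space M. near_span n m \<delta> i (\<lambda>x. u x + fst \<omega> x) (\<lambda>x. v x + snd \<omega> x)} \<in> sets M"
proof -
  have km: "(\<lambda>\<omega>. kr_entry (\<lambda>x. u x + fst \<omega> x) (\<lambda>x. v x + snd \<omega> x) j p)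
    \<in> borel_measurable M" if "j < m" "p \<in> {..<n} \<times> {..<n}" for j p
    unfolding M_def by (rule kr_entry_measurable[OF that])
  have c: "countable ({..<m} \<rightarrow>\<^sub>E (\<rat> :: real set))"
    by (intro countable_PiE) (auto simp: countable_rat)
  have "(\<lambda>\<omega>. \<Sum>p\<in>{..<n}\<times>{..<n}. (kr_entry (\<lambda>x. u x + fst \<omega> x) (\<lambda>x. v x + snd \<omega> x) i p -
      (\<Sum>j\<in>{..<m}-{i}. y j * kr_entry (\<lambda>x. u x + fst \<omega> x) (\<lambda>x. v x + snd \<omega> x) j p))\<^sup>2)
      \<in> borel_measurable M" for y
    using \<open>i < m\<close> by (intro borel_measurable_sum borel_measurable_power borel_measurable_diff
      borel_measurable_times km borel_measurable_const) auto
  then have "{\<omega> \<in> space M. (\<Sum>p\<in>{..<n}\<times>{..<n}. (kr_entry (\<lambda>x. u x + fst \<omega> x) (\<lambda>x. v x + snd \<omega> x) i p -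
      (\<Sum>j\<in>{..<m}-{i}. y j * kr_entry (\<lambda>x. u x + fst \<omega> x) (\<lambda>x. v x + snd \<omega> x) j p))\<^sup>2) < \<delta>\<^sup>2}
      \<in> sets M" for y
    by measurable
  then show ?thesis
    unfolding near_span_def by (intro sets.sets_Collect_countable_Ex' c)
qed

text \<open>\<open>B\<close> pairs to 0 with the other columns and hence sees only the residual of
  column \<open>i\<close>. Cauchy-Schwarz finishes, since \<open>n * n\<close> entries bounded by 1
  give \<open>B\<close> Euclidean norm at most \<open>n\<close>.\<close>

lemma near_span_imp_small_pairing:
  assumes "near_span n m \<delta> i u v" "0 \<le> \<delta>" "\<And>x. \<bar>B x\<bar> \<le> 1"
    and orth: "\<And>j. j \<in> {..<m} - {i} \<Longrightarrow> (\<Sum>p\<in>{..<n}\<times>{..<n}. B p * kr_entry u v j p) = 0"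
  shows "\<bar>\<Sum>p\<in>{..<n}\<times>{..<n}. B p * kr_entry u v i p\<bar> \<le> real n * \<delta>"
proof -
  let ?P = "{..<n} \<times> {..<n}" and ?J = "{..<m} - {i}"
  obtain y where y: "(\<Sum>p\<in>?P. (kr_entry u v i p - (\<Sum>j\<in>?J. y j * kr_entry u v j p))\<^sup>2) < \<delta>\<^sup>2"
    using assms(1) by (auto simp: near_span_def)
  let ?d = "\<lambda>p. kr_entry u v i p - (\<Sum>j\<in>?J. y j * kr_entry u v j p)"
  have "(\<Sum>p\<in>?P. B p * (\<Sum>j\<in>?J. y j * kr_entry u v j p))
      = (\<Sum>p\<in>?P. \<Sum>j\<in>?J. y j * (B p * kr_entry u v j p))"
    by (simp add: sum_distrib_left mult.left_commute)
  also have "\<dots> = (\<Sum>j\<in>?J. y j * (\<Sum>p\<in>?P. B p * kr_entry u v j p))"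
    by (subst sum.swap) (simp add: sum_distrib_left)
  also have "\<dots> = 0" using orth by simp
  finally have "(\<Sum>p\<in>?P. B p * kr_entry u v i p) = (\<Sum>p\<in>?P. B p * ?d p)"
    by (simp add: right_diff_distrib sum_subtractf)
  then have "(\<Sum>p\<in>?P. B p * kr_entry u v i p)\<^sup>2 = (\<Sum>p\<in>?P. B p * ?d p)\<^sup>2" by simp
  also have "\<dots> \<le> (\<Sum>p\<in>?P. (B p)\<^sup>2) * (\<Sum>p\<in>?P. (?d p)\<^sup>2)"
    by (rule Cauchy_Schwarz_ineq_sum)
  also have "\<dots> \<le> (\<Sum>p\<in>?P. 1) * \<delta>\<^sup>2"
    using assms(3) y by (intro mult_mono sum_mono sum_nonneg) (auto simp: abs_square_le_1)
  also have "\<dots> = (real n * \<delta>)\<^sup>2" by (simp add: power2_eq_square)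
  finally show ?thesis using assms(2) by (metis abs_le_square_iff abs_of_nonneg mult_nonneg_nonneg of_nat_0_le_iff)
qed

text \<open>Once all columns except \<open>i\<close> are frozen, the space orthogonal to them is
  deterministic and the anticoncentration bound applies to column \<open>i\<close>. The division by
  \<open>real n\<close> in the radius offsets the factor \<open>n\<close> lost to
  Cauchy-Schwarz.\<close>

lemma emeasure_near_span_le:
  fixes n m :: nat and \<rho> :: real
  defines "M \<equiv> gaussian_noise n m \<rho> \<Otimes>\<^sub>M gaussian_noise n m \<rho>"
  assumes \<rho>: "0 < \<rho>" and n: "2 \<le> n" and m: "2 * m \<le> n * n" and i: "i < m"
  shows "emeasure M {\<omega> \<in> space M. near_span n m (\<rho>\<^sup>2 * exp (- 40) / real n) i
      (\<lambda>x. u x + fst \<omega> x) (\<lambda>x. v x + snd \<omega> x)} \<le> ennreal ((real n + 1) * exp (- 5 * real n))"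
    (is "emeasure M ?S \<le> ?K")
proof -
  define R where "R = {..<n} \<times> ({..<m} - {i})"
  define C where "C = {..<n} \<times> {i}"
  have RC: "finite R" "finite C" "R \<inter> C = {}" "{..<n} \<times> {..<m} = R \<union> C"
    using i by (auto simp: R_def C_def)
  have M: "M = Pi\<^sub>M (R \<union> C) (\<lambda>_. gaussian \<rho>) \<Otimes>\<^sub>M Pi\<^sub>M (R \<union> C) (\<lambda>_. gaussian \<rho>)"
    by (simp add: M_def gaussian_noise_def RC(4))
  have S: "?S \<in> sets M" unfolding M_def by (rule near_span_measurable[OF i])
  have "emeasure (Pi\<^sub>M (R \<union> C) (\<lambda>_. gaussian \<rho>) \<Otimes>\<^sub>M Pi\<^sub>M (R \<union> C) (\<lambda>_. gaussian \<rho>)) ?S \<le> ?K"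
  proof (rule emeasure_pair_PiM_le[OF prob_space_normal_density[OF \<rho>] RC(1-3)])
    show "?S \<in> sets (Pi\<^sub>M (R \<union> C) (\<lambda>_. gaussian \<rho>) \<Otimes>\<^sub>M Pi\<^sub>M (R \<union> C) (\<lambda>_. gaussian \<rho>))"
      using S by (simp add: M)
  next
    fix x y :: "nat \<times> nat \<Rightarrow> real"
    let ?g = "\<lambda>g. merge R C (x, g)" and ?h = "\<lambda>h. merge R C (y, h)"
    let ?J = "{..<m} - {i}"
    let ?P = "{..<n} \<times> {..<n}"
    define c where "c = kr_entry (\<lambda>z. u z + x z) (\<lambda>z. v z + y z)"
    have on_C: "merge R C (z, g) (k, i) = g (k, i)" if "k < n" for z g :: "nat \<times> nat \<Rightarrow> real" and k
      using that RC(3) by (auto simp: merge_def C_def R_def)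
    have on_R: "merge R C (z, g) (k, j) = z (k, j)" if "k < n" "j \<in> ?J" for z g :: "nat \<times> nat \<Rightarrow> real" and k j
      using that by (auto simp: merge_def C_def R_def)
    have "2 * card ?J \<le> n * n" using m i by simp
    moreover have "\<bar>\<Sum>(k, l)\<in>?P. B (k, l) * ((u (k, i) + g (k, i)) * (v (l, i) + h (l, i)))\<bar>
        \<le> \<rho>\<^sup>2 * exp (- 40)"
      if nz: "indicator ?S (?g g, ?h h) \<noteq> (0 :: ennreal)" and B: "\<And>x. \<bar>B x\<bar> \<le> 1"
        and orth: "\<And>j. j \<in> ?J \<Longrightarrow> (\<Sum>p\<in>?P. B p * c j p) = 0" for g h B
    proof -
      let ?u = "\<lambda>z. u z + ?g g z" and ?v = "\<lambda>z. v z + ?h h z"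
      have near: "near_span n m (\<rho>\<^sup>2 * exp (- 40) / real n) i ?u ?v"
        using nz by (auto simp: indicator_eq_0_iff)
      have "(\<Sum>p\<in>?P. B p * kr_entry ?u ?v j p) = 0" if j: "j \<in> ?J" for j
      proof -
        have "(\<Sum>p\<in>?P. B p * kr_entry ?u ?v j p) = (\<Sum>p\<in>?P. B p * c j p)"
          using on_R[OF _ j] by (intro sum.cong refl) (auto simp: kr_entry_def c_def)
        then show ?thesis using orth[OF j] by simp
      qed
      from near_span_imp_small_pairing[OF near _ B this]
      have "\<bar>\<Sum>p\<in>?P. B p * kr_entry ?u ?v i p\<bar> \<le> \<rho>\<^sup>2 * exp (- 40)"
        using \<rho> n by simp
      also have "(\<Sum>p\<in>?P. B p * kr_entry ?u ?v i p)
          = (\<Sum>(k, l)\<in>?P. B (k, l) * ((u (k, i) + g (k, i)) * (v (l, i) + h (l, i))))"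
        using on_C by (intro sum.cong refl) (auto simp: kr_entry_def)
      finally show ?thesis .
    qed
    ultimately show "(\<integral>\<^sup>+h. \<integral>\<^sup>+g. indicator ?S (?g g, ?h h) \<partial>Pi\<^sub>M C (\<lambda>_. gaussian \<rho>)
        \<partial>Pi\<^sub>M C (\<lambda>_. gaussian \<rho>)) \<le> ?K"
      unfolding C_def
      by (intro gaussian_rank_one_anticoncentration[where J = ?J and c = c and a = "\<lambda>k. u (k, i)"
        and b = "\<lambda>l. v (l, i)"]) (use \<rho> n in \<open>auto simp: C_def indicator_def\<close>)
  qed
  then show ?thesis by (simp only: M [symmetric])
qed

section \<open>Eigenvalues of the Gram matrix and the least singular value\<close>

text \<open>\<open>proots\<close> counts real roots only. Splitting off linear factors shows that
  none is lost; this makes the index \<open>dim_col A - 1\<close> in \<open>sigma_min\<close> point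
  to an actual list entry.\<close>

lemma size_proots_eq_degree_if_real_rooted:
  fixes p :: "real poly"
  assumes "p \<noteq> 0" "\<And>z. poly (map_poly complex_of_real p) z = 0 \<Longrightarrow> z \<in> \<real>"
  shows "size (proots p) = degree p"
  using assms
proof (induction "degree p" arbitrary: p rule: less_induct)
  case less
  interpret poly_hom: map_poly_comm_ring_hom complex_of_real ..
  show ?case
  proof (cases "degree p = 0")
    case True
    then show ?thesis using size_proots_le[of p] by simp
  next
    case False
    then have "degree (map_poly complex_of_real p) > 0" by simp
    then obtain z where z: "poly (map_poly complex_of_real p) z = 0"
      using alg_closed_imp_poly_has_root by blast
    then obtain x where "z = complex_of_real x" using less.prems(2) by (auto elim: Reals_cases)
    then have "poly p x = 0" using z by simp
    then obtain q where q: "p = [:-x, 1:] * q" by (auto simp: poly_eq_0_iff_dvd)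
    then have q0: "q \<noteq> 0" using less.prems(1) by auto
    have deg: "degree p = Suc (degree q)" unfolding q using q0 by (subst degree_mult_eq) auto
    have "z' \<in> \<real>" if "poly (map_poly complex_of_real q) z' = 0" for z'
      using that by (intro less.prems(2)) (simp only: q poly_hom.hom_mult poly_mult mult_zero_right)
    then have "size (proots q) = degree q" using less.hyps[of q] deg q0 by simp
    moreover have "proots p = add_mset x (proots q)"
      unfolding q using q0 by (subst proots_mult) auto
    ultimately show ?thesis using deg by simp
  qed
qed

lemma eigenvector_sum:
  fixes S :: "'a :: comm_ring_1 Matrix.mat"
  assumes "S \<in> carrier_mat m m" "eigenvector S x k" "i < m"
  shows "(\<Sum>j<m. S $$ (i, j) * vec_index x j) = k * vec_index x i"
proof -
  have x: "x \<in> carrier_vec m" "S *\<^sub>v x = k \<cdot>\<^sub>v x" using assms by (auto simp: eigenvector_def)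
  have "vec_index (S *\<^sub>v x) i = (\<Sum>j<m. S $$ (i, j) * vec_index x j)"
    using assms(1,3) x(1) by (simp add: scalar_prod_def lessThan_atLeast0)
  then show ?thesis using assms(3) x by simp
qed

lemma gram_index:
  fixes A :: "'a :: comm_semiring_1 Matrix.mat"
  assumes "A \<in> carrier_mat N m" "i < m" "j < m"
  shows "(A\<^sup>T * A) $$ (i, j) = (\<Sum>p<N. A $$ (p, i) * A $$ (p, j))"
  using assms by (simp add: scalar_prod_def lessThan_atLeast0)

text \<open>The identity \<open>y^T (A^T A) w = (A y)^T (A w)\<close> in coordinates, general enough
  for both complex and real eigenvectors.\<close>

lemma gram_bilinear:
  fixes a :: "'p \<Rightarrow> 'j \<Rightarrow> 'a :: comm_semiring_1"
  shows "(\<Sum>i\<in>I. y i * (\<Sum>j\<in>J. (\<Sum>p\<in>P. a p i * a p j) * w j))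
    = (\<Sum>p\<in>P. (\<Sum>i\<in>I. a p i * y i) * (\<Sum>j\<in>J. a p j * w j))"
proof -
  have "(\<Sum>i\<in>I. y i * (\<Sum>j\<in>J. (\<Sum>p\<in>P. a p i * a p j) * w j))
      = (\<Sum>i\<in>I. \<Sum>j\<in>J. \<Sum>p\<in>P. (a p i * y i) * (a p j * w j))"
    by (simp add: sum_distrib_left sum_distrib_right mult_ac)
  also have "\<dots> = (\<Sum>i\<in>I. \<Sum>p\<in>P. \<Sum>j\<in>J. (a p i * y i) * (a p j * w j))"
    by (intro sum.cong refl sum.swap)
  also have "\<dots> = (\<Sum>p\<in>P. \<Sum>i\<in>I. \<Sum>j\<in>J. (a p i * y i) * (a p j * w j))"
    by (rule sum.swap)
  finally show ?thesis by (simp add: sum_product)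
qed

text \<open>For a complex eigenvector \<open>w\<close>, pairing the eigenvalue equation with its
  conjugate gives \<open>Q = z * W\<close>, where \<open>Q\<close> and \<open>W\<close> are the
  squared norms of \<open>A w\<close> and \<open>w\<close>; so \<open>z\<close> is a quotient of
  reals.\<close>

lemma gram_char_poly_real_rooted:
  fixes A :: "real Matrix.mat"
  assumes A: "A \<in> carrier_mat N m" and z: "poly (map_poly complex_of_real (char_poly (A\<^sup>T * A))) z = 0"
  shows "z \<in> \<real>"
proof -
  let ?S = "A\<^sup>T * A" and ?C = "map_mat complex_of_real (A\<^sup>T * A)"
  have S: "?S \<in> carrier_mat m m" and C: "?C \<in> carrier_mat m m" using A by auto
  have "eigenvalue ?C z"
    using z by (simp add: eigenvalue_root_char_poly[OF C] of_real_hom.char_poly_hom[OF S])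
  then obtain w where w: "eigenvector ?C w z" by (auto simp: eigenvalue_def)
  then have wc: "w \<in> carrier_vec m" "w \<noteq> 0\<^sub>v m" using C by (auto simp: eigenvector_def)
  let ?w = "\<lambda>i. vec_index w i"
  let ?a = "\<lambda>p i. complex_of_real (A $$ (p, i))"
  define Q where "Q = (\<Sum>p<N. (norm (\<Sum>j<m. ?a p j * ?w j))\<^sup>2)"
  define W where "W = (\<Sum>i<m. (norm (?w i))\<^sup>2)"
  have "?C $$ (i, j) = (\<Sum>p<N. ?a p i * ?a p j)" if "i < m" "j < m" for i j
  proof -
    have "?C $$ (i, j) = complex_of_real (?S $$ (i, j))"
      using S that by (intro index_map_mat(1)) auto
    then show ?thesis by (simp only: gram_index[OF A that] of_real_sum of_real_mult)
  qed
  then have "(\<Sum>j<m. (\<Sum>p<N. ?a p i * ?a p j) * ?w j) = z * ?w i" if "i < m" for i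
    using eigenvector_sum[OF C w that] that by (simp del: index_map_mat)
  then have "(\<Sum>i<m. cnj (?w i) * (\<Sum>j<m. (\<Sum>p<N. ?a p i * ?a p j) * ?w j))
      = (\<Sum>i<m. z * (?w i * cnj (?w i)))"
    by (intro sum.cong) auto
  also have "\<dots> = z * complex_of_real W"
    by (simp only: W_def sum_distrib_left of_real_sum complex_norm_square)
  also have "(\<Sum>i<m. cnj (?w i) * (\<Sum>j<m. (\<Sum>p<N. ?a p i * ?a p j) * ?w j)) = complex_of_real Q"
    unfolding gram_bilinear Q_def of_real_sum complex_norm_square
    by (intro sum.cong refl) (simp add: mult.commute)
  finally have "complex_of_real Q = z * complex_of_real W" .
  moreover have "W > 0"
  proof -
    obtain i where "i < m" "?w i \<noteq> 0"
      using wc by (metis carrier_vecD eq_vecI index_zero_vec)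
    then show ?thesis unfolding W_def by (intro sum_pos2[of _ i]) auto
  qed
  ultimately have "z = complex_of_real (Q / W)" by (simp add: field_simps)
  then show ?thesis by simp
qed

lemma gram_eigenvalueE:
  fixes A :: "real Matrix.mat"
  assumes A: "A \<in> carrier_mat N m" and "eigenvalue (A\<^sup>T * A) \<mu>"
  obtains x i where "i < m" "x i \<noteq> 0"
    "(\<Sum>p<N. (\<Sum>j<m. A $$ (p, j) * x j)\<^sup>2) = \<mu> * (\<Sum>j<m. (x j)\<^sup>2)"
proof -
  have S: "A\<^sup>T * A \<in> carrier_mat m m" using A by auto
  obtain w where w: "eigenvector (A\<^sup>T * A) w \<mu>" using assms by (auto simp: eigenvalue_def)
  then have wc: "w \<in> carrier_vec m" "w \<noteq> 0\<^sub>v m" using S by (auto simp: eigenvector_def)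
  let ?w = "\<lambda>i. vec_index w i"
  obtain i where i: "i < m" "?w i \<noteq> 0"
    using wc by (metis carrier_vecD eq_vecI index_zero_vec)
  have "(\<Sum>j<m. (\<Sum>p<N. A $$ (p, i) * A $$ (p, j)) * ?w j) = \<mu> * ?w i" if "i < m" for i
    using eigenvector_sum[OF S w that] gram_index[OF A that] by simp
  then have "(\<Sum>i<m. ?w i * (\<Sum>j<m. (\<Sum>p<N. A $$ (p, i) * A $$ (p, j)) * ?w j))
      = (\<Sum>i<m. ?w i * (\<mu> * ?w i))"
    by (intro sum.cong) auto
  then have "(\<Sum>p<N. (\<Sum>j<m. A $$ (p, j) * ?w j)\<^sup>2) = \<mu> * (\<Sum>j<m. (?w j)\<^sup>2)"
    unfolding gram_bilinear by (simp add: power2_eq_square sum_distrib_left mult_ac)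
  with i show thesis using that by blast
qed

text \<open>As all \<open>m\<close> eigenvalues are real, \<open>sigma_min\<close> picks the least
  of their square roots. The eigenvalue form serves both the measurability proof and the
  estimate.\<close>

lemma sigma_min_ge_iff:
  fixes A :: "real Matrix.mat"
  assumes A: "A \<in> carrier_mat N m" and m: "1 \<le> m" and \<tau>: "0 < \<tau>"
  shows "\<tau> \<le> sigma_min A \<longleftrightarrow> (\<forall>\<mu><\<tau>\<^sup>2. \<not> eigenvalue (A\<^sup>T * A) \<mu>)"
proof -
  let ?S = "A\<^sup>T * A"
  have S: "?S \<in> carrier_mat m m" using A by auto
  define p where "p = char_poly ?S"
  have p: "degree p = m" "p \<noteq> 0" using degree_monic_char_poly[OF S] m by (auto simp: p_def)
  define xs where "xs = sorted_list_of_multiset (image_mset sqrt (proots p))"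
  have "size (proots p) = m"
    using size_proots_eq_degree_if_real_rooted[OF p(2)] gram_char_poly_real_rooted[OF A] p
    by (simp add: p_def)
  then have len: "length xs = m" unfolding xs_def by (metis size_image_mset size_mset mset_sorted_list_of_multiset)
  have sorted: "sorted xs" by (simp add: xs_def)
  have "sigma_min A = rev xs ! (m - 1)"
    using A by (simp add: sigma_min_def singular_values_def xs_def p_def)
  then have "sigma_min A = xs ! 0" using len m by (simp add: rev_nth)
  moreover have "xs ! 0 \<in> set xs" using len m by simp
  moreover have "xs ! 0 \<le> x" if "x \<in> set xs" for x
    using that sorted_nth_mono[OF sorted, of 0] by (auto simp: in_set_conv_nth)
  ultimately have "\<tau> \<le> sigma_min A \<longleftrightarrow> (\<forall>x\<in>set xs. \<tau> \<le> x)"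
    by (metis order_trans)
  also have "set xs = sqrt ` {\<mu>. eigenvalue ?S \<mu>}"
    using p by (simp add: xs_def eigenvalue_root_char_poly[OF S] p_def)
  also have "(\<forall>x\<in>sqrt ` {\<mu>. eigenvalue ?S \<mu>}. \<tau> \<le> x) \<longleftrightarrow> (\<forall>\<mu>. eigenvalue ?S \<mu> \<longrightarrow> \<tau>\<^sup>2 \<le> \<mu>)"
    using \<tau> real_le_rsqrt sqrt_ge_absD by (fastforce)
  finally show ?thesis by (meson not_le)
qed

section \<open>Measurability of the singular value event\<close>

text \<open>A continuous function without zeros below \<open>t\<close> is bounded away from 0 on compact intervals
  below \<open>t\<close>, which can be tested on rational points.\<close>

lemma sets_no_root_below:
  fixes F :: "'a \<Rightarrow> real \<Rightarrow> real"
  assumes F[measurable]: "\<And>\<mu>. (\<lambda>\<omega>. F \<omega> \<mu>) \<in> borel_measurable M"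
    and cont: "\<And>\<omega>. continuous_on UNIV (F \<omega>)"
  shows "{\<omega> \<in> space M. \<forall>\<mu><t. F \<omega> \<mu> \<noteq> 0} \<in> sets M"
proof -
  \<comment> \<open>The intervals indexed by \<open>k\<close> exhaust the half-line below
    \<open>t\<close>; \<open>j\<close> encodes a positive lower bound on each of them.\<close>
  have "(\<forall>\<mu><t. F \<omega> \<mu> \<noteq> 0) \<longleftrightarrow> (\<forall>k::nat. \<exists>j::nat. \<forall>q::rat.
      real_of_rat q \<in> {- real k .. t - 1 / (real k + 1)} \<longrightarrow> 1 / (real j + 1) \<le> \<bar>F \<omega> (real_of_rat q)\<bar>)"
    (is "?L \<longleftrightarrow> ?R") for \<omega>
  proof
    assume L: ?L
    show ?R
    proof
      fix k :: nat
      let ?I = "{- real k .. t - 1 / (real k + 1)}"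
      show "\<exists>j::nat. \<forall>q::rat. real_of_rat q \<in> ?I \<longrightarrow> 1 / (real j + 1) \<le> \<bar>F \<omega> (real_of_rat q)\<bar>"
      proof (cases "?I = {}")
        case False
        have "continuous_on ?I (\<lambda>\<mu>. \<bar>F \<omega> \<mu>\<bar>)"
          using cont continuous_on_subset by (blast intro: continuous_on_rabs)
        then obtain x where x: "x \<in> ?I" "\<And>y. y \<in> ?I \<Longrightarrow> \<bar>F \<omega> x\<bar> \<le> \<bar>F \<omega> y\<bar>"
          using continuous_attains_inf[OF compact_Icc False] by blast
        have "1 / (real k + 1) > 0" by simp
        then have "x < t" using x(1) unfolding atLeastAtMost_iff by linarith
        then have "\<bar>F \<omega> x\<bar> > 0" using L by auto
        then obtain j where "inverse (real (Suc j)) < \<bar>F \<omega> x\<bar>" using reals_Archimedean by blast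
        then have j: "1 / (real j + 1) < \<bar>F \<omega> x\<bar>" by (simp add: inverse_eq_divide add.commute)
        show ?thesis
          using x(2) j by (intro exI[of _ j]) (meson less_le_trans order.strict_implies_order)
      qed auto
    qed
  next
    assume R: ?R
    show ?L
    proof (intro allI impI notI)
      fix \<mu> assume lt: "\<mu> < t" and 0: "F \<omega> \<mu> = 0"
      obtain k1 where k1: "inverse (real (Suc k1)) < t - \<mu>"
        using reals_Archimedean[of "t - \<mu>"] lt by auto
      obtain k2 where k2: "- \<mu> < real k2" using reals_Archimedean2 by blast
      define k where "k = max k1 k2"
      have "1 / (real k + 1) \<le> inverse (real (Suc k1))"
        by (simp add: inverse_eq_divide k_def frac_le)
      then have k: "- real k < \<mu>" "\<mu> < t - 1 / (real k + 1)" using k1 k2 by (auto simp: k_def)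
      obtain j where j: "\<And>q. real_of_rat q \<in> {- real k .. t - 1 / (real k + 1)} \<Longrightarrow>
          1 / (real j + 1) \<le> \<bar>F \<omega> (real_of_rat q)\<bar>" using R by blast
      have "isCont (F \<omega>) \<mu>" using cont by (simp add: continuous_on_eq_continuous_at)
      moreover have "1 / (real j + 1) > 0" by simp
      ultimately obtain d where d: "d > 0" "\<And>y. dist y \<mu> < d \<Longrightarrow> dist (F \<omega> y) (F \<omega> \<mu>) < 1 / (real j + 1)"
        unfolding continuous_at_eps_delta by blast
      \<comment> \<open>A rational point just above the root \<open>\<mu>\<close> stays inside the
        interval and is close enough for continuity to violate the lower bound.\<close>
      have "\<mu> < min (\<mu> + d) (t - 1 / (real k + 1))" using d k by simp
      then obtain q where q: "\<mu> < real_of_rat q" "real_of_rat q < min (\<mu> + d) (t - 1 / (real k + 1))"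
        using of_rat_dense by blast
      then have "\<bar>F \<omega> (real_of_rat q)\<bar> < 1 / (real j + 1)"
        using d(2)[of "real_of_rat q"] 0 by (simp add: dist_real_def)
      then show False using j[of q] q k by simp
    qed
  qed
  then have "{\<omega> \<in> space M. \<forall>\<mu><t. F \<omega> \<mu> \<noteq> 0} = {\<omega> \<in> space M. \<forall>k::nat. \<exists>j::nat. \<forall>q::rat.
      real_of_rat q \<in> {- real k .. t - 1 / (real k + 1)} \<longrightarrow> 1 / (real j + 1) \<le> \<bar>F \<omega> (real_of_rat q)\<bar>}"
    by simp
  also have "\<dots> \<in> sets M" by measurable
  finally show ?thesis .
qed

text \<open>\<open>F\<close> is the Leibniz expansion of the determinant of the Gram matrix minus
  \<open>\<mu>\<close> times the identity: measurable in \<open>\<omega>\<close>, continuous in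
  \<open>\<mu>\<close>, and zero exactly at eigenvalues.\<close>

lemma sets_sigma_min_ge:
  fixes A :: "'a \<Rightarrow> real Matrix.mat"
  assumes A: "\<And>\<omega>. A \<omega> \<in> carrier_mat N m" and m: "1 \<le> m" and \<tau>: "0 < \<tau>"
    and entry: "\<And>p j. p < N \<Longrightarrow> j < m \<Longrightarrow> (\<lambda>\<omega>. A \<omega> $$ (p, j)) \<in> borel_measurable M"
  shows "{\<omega> \<in> space M. \<tau> \<le> sigma_min (A \<omega>)} \<in> sets M"
proof -
  let ?S = "\<lambda>\<omega>. (A \<omega>)\<^sup>T * A \<omega>"
  define F where "F \<omega> \<mu> = (\<Sum>\<pi>\<in>{\<pi>. \<pi> permutes {0..<m}}. signof \<pi> *
    (\<Prod>i=0..<m. (\<Sum>p<N. A \<omega> $$ (p, i) * A \<omega> $$ (p, \<pi> i)) - \<mu> * (if i = \<pi> i then 1 else 0)))" for \<omega> \<mu>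
  have S: "?S \<omega> \<in> carrier_mat m m" for \<omega> using A[of \<omega>] by auto
  have ev: "eigenvalue (?S \<omega>) \<mu> \<longleftrightarrow> F \<omega> \<mu> = 0" for \<omega> \<mu>
  proof -
    have "Determinant.det (char_matrix (?S \<omega>) \<mu>) = F \<omega> \<mu>"
      unfolding det_def'[OF char_matrix_closed[OF S]] F_def
    proof (intro sum.cong refl arg_cong2[where f = "(*)"] prod.cong)
      fix \<pi> i assume "\<pi> \<in> {\<pi>. \<pi> permutes {0..<m}}" "i \<in> {0..<m}"
      then have i: "i < m" "\<pi> i < m" using permutes_in_image[of \<pi> "{0..<m}" i] by auto
      then show "char_matrix (?S \<omega>) \<mu> $$ (i, \<pi> i) =
          (\<Sum>p<N. A \<omega> $$ (p, i) * A \<omega> $$ (p, \<pi> i)) - \<mu> * (if i = \<pi> i then 1 else 0)"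
        using S[of \<omega>] gram_index[OF A i] A[of \<omega>] by (simp add: char_matrix_def del: index_mult_mat(1))
    qed
    then show ?thesis by (simp add: eigenvalue_det[OF S])
  qed
  have "(\<lambda>\<omega>. F \<omega> \<mu>) \<in> borel_measurable M" for \<mu>
    unfolding F_def
  proof (intro borel_measurable_sum borel_measurable_times borel_measurable_prod
      borel_measurable_diff borel_measurable_const)
    fix \<pi> i p assume a: "\<pi> \<in> {\<pi>. \<pi> permutes {0..<m}}" "i \<in> {0..<m}" "p \<in> {..<N}"
    then have "i < m" "\<pi> i < m" using permutes_in_image[of \<pi> "{0..<m}" i] by auto
    then show "(\<lambda>\<omega>. A \<omega> $$ (p, i)) \<in> borel_measurable M" "(\<lambda>\<omega>. A \<omega> $$ (p, \<pi> i)) \<in> borel_measurable M"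
      using a entry by auto
  qed
  moreover have "continuous_on UNIV (F \<omega>)" for \<omega>
    unfolding F_def[abs_def] by (intro continuous_intros)
  ultimately have "{\<omega> \<in> space M. \<forall>\<mu><\<tau>\<^sup>2. F \<omega> \<mu> \<noteq> 0} \<in> sets M"
    by (rule sets_no_root_below)
  then show ?thesis by (simp add: sigma_min_ge_iff[OF A m \<tau>] ev)
qed

section \<open>From a small singular value to a nearly dependent column\<close>

lemma sum_div_mod_square:
  fixes f :: "nat \<times> nat \<Rightarrow> 'a :: comm_monoid_add"
  shows "(\<Sum>p<n*n. f (p div n, p mod n)) = (\<Sum>p\<in>{..<n}\<times>{..<n}. f p)"
proof (rule sum.reindex_bij_witness[of _ "\<lambda>(k, l). k * n + l" "\<lambda>p. (p div n, p mod n)"])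
  fix x assume "x \<in> {..<n} \<times> {..<n}"
  then obtain k l where x: "x = (k, l)" "k < n" "l < n" by auto
  then have "k * n + l < (k + 1) * n" by simp
  also have "\<dots> \<le> n * n" using x by (intro mult_right_mono) auto
  finally show "(case x of (k, l) \<Rightarrow> k * n + l) \<in> {..<n * n}" by (simp add: x)
  show "((case x of (k, l) \<Rightarrow> k * n + l) div n, (case x of (k, l) \<Rightarrow> k * n + l) mod n) = x"
    using x by simp
next
  fix p assume p: "p \<in> {..<n * n}"
  then have "0 < n" by (cases n) auto
  then show "(p div n, p mod n) \<in> {..<n} \<times> {..<n}"
    using p by (auto intro: less_mult_imp_div_less)
qed auto

lemma khatri_rao_carrier:
  assumes "A \<in> carrier_mat n m" "B \<in> carrier_mat n m"
  shows "khatri_rao A B \<in> carrier_mat (n * n) m"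
  using assms by (auto simp: khatri_rao_def)

lemma khatri_rao_perturb_index:
  assumes U: "U \<in> carrier_mat n m" and V: "V \<in> carrier_mat n m" and p: "p < n * n" and j: "j < m"
  shows "khatri_rao (perturb U g) (perturb V h) $$ (p, j)
    = kr_entry (\<lambda>x. U $$ x + g x) (\<lambda>x. V $$ x + h x) j (p div n, p mod n)"
proof -
  have "0 < n" using p by (cases n) auto
  then have "p div n < n" "p mod n < n" using p by (auto intro: less_mult_imp_div_less)
  then show ?thesis
    using assms by (simp add: khatri_rao_def kron_vec_def perturb_def kr_entry_def mat_of_cols_index)
qed

lemma real_limit_of_rationals:
  fixes y :: "nat \<Rightarrow> real"
  obtains q where "\<And>k j. q k j \<in> \<rat>" "\<And>j. (\<lambda>k. q k j) \<longlonglongrightarrow> y j"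
proof -
  define q where "q k j = (SOME r. r \<in> \<rat> \<and> y j < r \<and> r < y j + inverse (real (Suc k)))" for k j
  have "\<exists>r. r \<in> \<rat> \<and> y j < r \<and> r < y j + inverse (real (Suc k))" for k j
    using Rats_dense_in_real[of "y j" "y j + inverse (real (Suc k))"] by auto
  from someI_ex[OF this]
  have "q k j \<in> \<rat> \<and> y j < q k j \<and> q k j < y j + inverse (real (Suc k))" for k j
    unfolding q_def .
  then have q: "q k j \<in> \<rat>" "y j < q k j" "q k j < y j + inverse (real (Suc k))" for k j
    by blast+
  have "(\<lambda>k. q k j) \<longlonglongrightarrow> y j" for j
  proof (rule tendsto_sandwich)
    show "\<forall>\<^sub>F k in sequentially. y j \<le> q k j" using q(2) by (simp add: less_imp_le)
    show "\<forall>\<^sub>F k in sequentially. q k j \<le> y j + inverse (real (Suc k))"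
      using q(3) by (simp add: less_imp_le)
    show "(\<lambda>k. y j + inverse (real (Suc k))) \<longlonglongrightarrow> y j" by (rule LIMSEQ_inverse_real_of_nat_add)
  qed simp
  with q(1) show thesis using that by blast
qed

text \<open>Dividing the small combination by the coefficient \<open>x i\<close> of largest modulus
  expresses column \<open>i\<close> approximately through the others. As the squared norm of
  \<open>x\<close> is at most \<open>m\<close> times the square of \<open>x i\<close>, only a factor
  \<open>sqrt m\<close> is lost.\<close>

lemma exists_near_span_if_small_combination:
  assumes x: "i0 < m" "x i0 \<noteq> 0"
    and small: "(\<Sum>p\<in>{..<n}\<times>{..<n}. (\<Sum>j<m. kr_entry u v j p * x j)\<^sup>2) < \<tau>\<^sup>2 * (\<Sum>j<m. (x j)\<^sup>2)"
    and \<delta>: "\<tau>\<^sup>2 * real m \<le> \<delta>\<^sup>2"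
  shows "\<exists>i<m. near_span n m \<delta> i u v"
proof -
  let ?P = "{..<n} \<times> {..<n}"
  let ?k = "kr_entry u v"
  define i where "i = arg_min_on (\<lambda>j. - \<bar>x j\<bar>) {..<m}"
  have "finite {..<m}" "{..<m} \<noteq> {}" using x by auto
  from arg_min_if_finite[OF this, of "\<lambda>j. - \<bar>x j\<bar>"]
  have i: "i < m" "\<And>j. j < m \<Longrightarrow> \<bar>x j\<bar> \<le> \<bar>x i\<bar>" unfolding i_def by (force simp: not_less)+
  have xi: "x i \<noteq> 0" using i(2)[OF x(1)] x(2) by auto
  let ?J = "{..<m} - {i}"
  define D where "D y = (\<Sum>p\<in>?P. (?k i p - (\<Sum>j\<in>?J. y j * ?k j p))\<^sup>2)" for y
  define y where "y j = - x j / x i" for j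
  have eq: "?k i p - (\<Sum>j\<in>?J. y j * ?k j p) = (\<Sum>j<m. ?k j p * x j) / x i" for p
  proof -
    have "(\<Sum>j<m. ?k j p * x j) = ?k i p * x i + (\<Sum>j\<in>?J. ?k j p * x j)"
      using i by (subst sum.remove[of _ i]) auto
    moreover have "(\<Sum>j\<in>?J. y j * ?k j p) = - (\<Sum>j\<in>?J. ?k j p * x j) / x i"
      by (simp add: y_def sum_divide_distrib sum_negf mult.commute)
    ultimately show ?thesis using xi by (simp add: field_simps)
  qed
  have "D y = (\<Sum>p\<in>?P. (\<Sum>j<m. ?k j p * x j)\<^sup>2) / (x i)\<^sup>2"
    by (simp add: D_def eq power_divide flip: sum_divide_distrib)
  also have "\<dots> < \<tau>\<^sup>2 * (\<Sum>j<m. (x j)\<^sup>2) / (x i)\<^sup>2"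
    using small xi by (intro divide_strict_right_mono) auto
  also have "\<dots> \<le> \<tau>\<^sup>2 * (\<Sum>j<m. (x i)\<^sup>2) / (x i)\<^sup>2"
    using i(2) by (intro divide_right_mono mult_left_mono sum_mono) (auto simp: abs_le_square_iff)
  also have "\<dots> \<le> \<delta>\<^sup>2" using \<delta> xi by simp
  finally have Dy: "D y < \<delta>\<^sup>2" .
  obtain q where q: "\<And>k j. q k j \<in> \<rat>" "\<And>j. (\<lambda>k. q k j) \<longlonglongrightarrow> y j"
    using real_limit_of_rationals by blast
  \<comment> \<open>The strict bound at the real coefficients \<open>y\<close> persists at nearby
    rational ones by continuity.\<close>
  have "(\<lambda>k. D (q k)) \<longlonglongrightarrow> D y"
    unfolding D_def by (intro tendsto_intros q)
  then have "\<forall>\<^sub>F k in sequentially. D (q k) < \<delta>\<^sup>2" using Dy by (rule order_tendstoD)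
  then obtain k where k: "D (q k) < \<delta>\<^sup>2" using eventually_happens by force
  \<comment> \<open>\<open>near_span\<close> asks for extensional functions, and \<open>D\<close>
    reads only coordinates below \<open>m\<close>.\<close>
  have "D (restrict (q k) {..<m}) = D (q k)"
    unfolding D_def by (intro sum.cong refl arg_cong[where f = "\<lambda>s. (_ - s)\<^sup>2"]) auto
  then have "near_span n m \<delta> i u v"
    unfolding near_span_def using k q(1) by (intro bexI[of _ "restrict (q k) {..<m}"]) (auto simp: D_def)
  with i(1) show ?thesis by blast
qed

lemma sigma_min_khatri_rao_less_imp_near_span:
  assumes U: "U \<in> carrier_mat n m" and V: "V \<in> carrier_mat n m" and m: "1 \<le> m"
    and \<tau>: "0 < \<tau>" "\<tau>\<^sup>2 * real m \<le> \<delta>\<^sup>2"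
    and less: "sigma_min (khatri_rao (perturb U g) (perturb V h)) < \<tau>"
  shows "\<exists>i<m. near_span n m \<delta> i (\<lambda>x. U $$ x + g x) (\<lambda>x. V $$ x + h x)"
proof -
  let ?A = "khatri_rao (perturb U g) (perturb V h)"
  let ?k = "kr_entry (\<lambda>x. U $$ x + g x) (\<lambda>x. V $$ x + h x)"
  have A: "?A \<in> carrier_mat (n * n) m"
    using U V by (intro khatri_rao_carrier) (auto simp: perturb_def)
  obtain \<mu> where \<mu>: "\<mu> < \<tau>\<^sup>2" "eigenvalue (?A\<^sup>T * ?A) \<mu>"
    using less sigma_min_ge_iff[OF A m \<tau>(1)] by force
  obtain x i where x: "i < m" "x i \<noteq> 0"
    and e: "(\<Sum>p<n*n. (\<Sum>j<m. ?A $$ (p, j) * x j)\<^sup>2) = \<mu> * (\<Sum>j<m. (x j)\<^sup>2)"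
    using gram_eigenvalueE[OF A \<mu>(2)] by blast
  have "(\<Sum>p\<in>{..<n}\<times>{..<n}. (\<Sum>j<m. ?k j p * x j)\<^sup>2) = (\<Sum>p<n*n. (\<Sum>j<m. ?A $$ (p, j) * x j)\<^sup>2)"
    unfolding sum_div_mod_square[symmetric]
    by (intro sum.cong refl arg_cong[where f = "\<lambda>s. s\<^sup>2"]) (simp add: khatri_rao_perturb_index[OF U V])
  also have "\<dots> < \<tau>\<^sup>2 * (\<Sum>j<m. (x j)\<^sup>2)"
    unfolding e using x \<mu>(1) by (intro mult_strict_right_mono sum_pos2[of _ i]) auto
  finally show ?thesis
    using exists_near_span_if_small_combination[where x = x and \<tau> = \<tau>, OF x(1,2)] \<tau>(2) by blast
qed

section \<open>Union bound and choice of constants\<close>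

text \<open>Three uses of \<open>real n + 1 \<le> exp (real n)\<close> absorb the polynomial factor
  into \<open>exp (3 * real n)\<close>, which the decay rate 5 outweighs.\<close>

lemma union_bound_le_exp:
  fixes n m :: nat
  assumes "m \<le> n * n"
  shows "real m * ((real n + 1) * exp (- 5 * real n)) \<le> exp (- real n)"
proof -
  let ?e = "exp (real n)"
  have e: "real n + 1 \<le> ?e" using exp_ge_add_one_self[of "real n"] by (simp add: add.commute)
  have "real m * (real n + 1) \<le> (real n * real n) * (real n + 1)"
    using assms by (intro mult_right_mono) (auto simp flip: of_nat_mult)
  also have "\<dots> \<le> (?e * ?e) * ?e" using e by (intro mult_mono) auto
  also have "\<dots> = exp (3 * real n)" by (simp add: mult_exp_exp)
  finally have "real m * (real n + 1) * exp (- 5 * real n) \<le> exp (3 * real n) * exp (- 5 * real n)"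
    by (intro mult_right_mono) auto
  also have "\<dots> \<le> exp (- real n)" by (simp add: mult_exp_exp)
  finally show ?thesis by (simp add: mult.assoc)
qed

theorem theorem6p4:
  shows "\<exists>C>0::real. \<exists>c>0::real. \<exists>\<kappa>>0::real. \<exists>a b :: nat.
    \<forall>(n::nat) (m::nat) (\<rho>::real) (U::real Matrix.mat) (V::real Matrix.mat).
      1 \<le> m \<longrightarrow> 0 < \<rho> \<longrightarrow> U \<in> carrier_mat n m \<longrightarrow> V \<in> carrier_mat n m \<longrightarrow>
      real m \<le> (real n)\<^sup>2 / C \<longrightarrow>
      measure (gaussian_noise n m \<rho> \<Otimes>\<^sub>M gaussian_noise n m \<rho>)
        {(g, h) \<in> space (gaussian_noise n m \<rho> \<Otimes>\<^sub>M gaussian_noise n m \<rho>).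
          sigma_min (khatri_rao (perturb U g) (perturb V h)) \<ge> \<kappa> * \<rho> ^ a * (1 / real n) ^ b}
      \<ge> 1 - exp (- c * real n)"
proof (rule exI[of _ 2], intro conjI, simp, rule exI[of _ 1], intro conjI, simp,
    rule exI[of _ "exp (- 40)"], intro conjI, simp, rule exI[of _ 2], rule exI[of _ 2],
    intro allI impI)
  \<comment> \<open>\<open>C = 2\<close> leaves the complement of the other columns at least n^2/2
    dimensions; the rate \<open>c = 1\<close> survives the union bound.\<close>
  fix n m :: nat and \<rho> :: real and U V :: "real Matrix.mat"
  assume m: "1 \<le> m" and \<rho>: "0 < \<rho>" and U: "U \<in> carrier_mat n m" and V: "V \<in> carrier_mat n m"
    and mn: "real m \<le> (real n)\<^sup>2 / 2"
  define M where "M = gaussian_noise n m \<rho> \<Otimes>\<^sub>M gaussian_noise n m \<rho>"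
  \<comment> \<open>\<open>\<tau>\<close> equals \<open>\<delta> / real n\<close>: one factor 1/n
    comes from Cauchy-Schwarz, the other from \<open>sqrt m \<le> n\<close>. This explains the
    exponents \<open>a = b = 2\<close>.\<close>
  define \<tau> where "\<tau> = exp (- 40) * \<rho>\<^sup>2 * (1 / real n)\<^sup>2"
  define \<delta> where "\<delta> = \<rho>\<^sup>2 * exp (- 40) / real n"
  define A where "A \<omega> = khatri_rao (perturb U (fst \<omega>)) (perturb V (snd \<omega>))" for \<omega>
  define bad where "bad i = {\<omega> \<in> space M. near_span n m \<delta> i (\<lambda>x. U $$ x + fst \<omega> x) (\<lambda>x. V $$ x + snd \<omega> x)}" for i
  let ?good = "{\<omega> \<in> space M. \<tau> \<le> sigma_min (A \<omega>)}"
  have "real (2 * m) \<le> real (n * n)" using mn by (simp add: power2_eq_square)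
  then have m2: "2 * m \<le> n * n" by (simp only: of_nat_le_iff)
  \<comment> \<open>From \<open>2 \<le> 2 * m \<le> n * n\<close>; in particular the divisions by
    \<open>real n\<close> are genuine.\<close>
  have n: "2 \<le> n"
  proof (rule ccontr)
    assume "\<not> 2 \<le> n"
    then have "n = 0 \<or> n = 1" by auto
    then show False using m2 m by auto
  qed
  have \<tau>: "0 < \<tau>" using \<rho> n by (simp add: \<tau>_def)
  have "\<tau>\<^sup>2 * real m \<le> \<tau>\<^sup>2 * (real n)\<^sup>2"
    using mn zero_le_power2[of "real n"] by (intro mult_left_mono) (linarith, simp)
  also have "\<dots> = (\<tau> * real n)\<^sup>2" by (rule power_mult_distrib [symmetric])
  also have "\<tau> * real n = \<delta>" using n by (simp add: \<tau>_def \<delta>_def power2_eq_square)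
  finally have \<tau>\<delta>: "\<tau>\<^sup>2 * real m \<le> \<delta>\<^sup>2" .
  interpret G: prob_space "gaussian_noise n m \<rho>"
    unfolding gaussian_noise_def by (rule prob_space_gaussian_product[OF \<rho>])
  interpret GG: pair_prob_space "gaussian_noise n m \<rho>" "gaussian_noise n m \<rho>" ..
  interpret M: prob_space M unfolding M_def by unfold_locales
  have carrier: "A \<omega> \<in> carrier_mat (n * n) m" for \<omega>
    unfolding A_def using U V by (intro khatri_rao_carrier) (auto simp: perturb_def)
  have good: "?good \<in> sets M"
  proof (rule sets_sigma_min_ge[OF carrier m \<tau>])
    fix p j assume p: "p < n * n" and j: "j < m"
    have "0 < n" using n by simp
    then have "(p div n, p mod n) \<in> {..<n} \<times> {..<n}"
      using p by (auto intro: less_mult_imp_div_less)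
    then show "(\<lambda>\<omega>. A \<omega> $$ (p, j)) \<in> borel_measurable M"
      unfolding A_def khatri_rao_perturb_index[OF U V p j] M_def by (rule kr_entry_measurable[OF j])
  qed
  have bad: "bad i \<in> sets M" if "i < m" for i
    unfolding bad_def M_def by (rule near_span_measurable[OF that])
  have "space M - ?good \<subseteq> (\<Union>i<m. bad i)"
  proof
    fix \<omega> assume "\<omega> \<in> space M - ?good"
    then have \<omega>: "\<omega> \<in> space M" "sigma_min (A \<omega>) < \<tau>" by auto
    show "\<omega> \<in> (\<Union>i<m. bad i)"
      using sigma_min_khatri_rao_less_imp_near_span[OF U V m \<tau> \<tau>\<delta> \<omega>(2)[unfolded A_def]] \<omega>(1)
      by (simp add: bad_def Bex_def)
  qed
  then have "emeasure M (space M - ?good) \<le> emeasure M (\<Union>i<m. bad i)"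
    using bad by (intro emeasure_mono) auto
  also have "\<dots> \<le> (\<Sum>i<m. emeasure M (bad i))"
    using bad by (intro emeasure_subadditive_finite) auto
  also have "\<dots> \<le> (\<Sum>i<m. ennreal ((real n + 1) * exp (- 5 * real n)))"
    unfolding bad_def \<delta>_def M_def
    by (intro sum_mono emeasure_near_span_le[OF \<rho> n m2]) simp
  also have "\<dots> = ennreal (real m * ((real n + 1) * exp (- 5 * real n)))"
    by (simp add: ennreal_of_nat_eq_real_of_nat ennreal_mult)
  also have "\<dots> \<le> ennreal (exp (- real n))"
    using m2 by (intro ennreal_leI union_bound_le_exp) simp
  finally have "measure M (space M - ?good) \<le> exp (- real n)"
    by (simp add: M.emeasure_eq_measure)
  then have "1 - exp (- 1 * real n) \<le> measure M ?good"
    using M.prob_compl[OF good] by simp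
  also have "?good = {(g, h) \<in> space M. exp (- 40) * \<rho> ^ 2 * (1 / real n) ^ 2
      \<le> sigma_min (khatri_rao (perturb U g) (perturb V h))}"
    by (auto simp: A_def \<tau>_def)
  finally show "1 - exp (- 1 * real n) \<le> measure (gaussian_noise n m \<rho> \<Otimes>\<^sub>M gaussian_noise n m \<rho>)
      {(g, h) \<in> space (gaussian_noise n m \<rho> \<Otimes>\<^sub>M gaussian_noise n m \<rho>).
        exp (- 40) * \<rho> ^ 2 * (1 / real n) ^ 2 \<le> sigma_min (khatri_rao (perturb U g) (perturb V h))}"
    unfolding M_def .
qed

end
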